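(* Let $\mathbb{V}$ be a $7$-dimensional real vector space with a euclidean inner product $\langle -,-\rangle$, and let $F\in\Lambda^3\mathbb{V}^*$. Then $[\iota_X F, F]=0$ for all $X\in\mathbb{V}$ if and only if $F=F_1+F_2$ for some simple $3$-forms $F_1,F_2\in\Lambda^3\mathbb{V}^*$ which are orthogonal to each other.
   Context: Euclidean means positive-definite. $\iota_X F$ is the $2$-form $F(X,-,-)$. A $2$-form $\omega\in\Lambda^2\mathbb{V}^*\cong\mathfrak{so}(\mathbb{V})$ acts on forms $\Omega\in\Lambda\mathbb{V}^*$ by $[\omega,\Omega]$, defined for $\omega=\alpha\wedge\beta$ with $\alpha,\beta\in\mathbb{V}^*$ by $$[\alpha\wedge\beta,\Omega]=\alpha\wedge\iota_{\beta^\sharp}\Omega-\beta\wedge\iota_{\alpha^\sharp}\Omega$$ and extended linearly in $\omega$, where $\alpha^\sharp\in\mathbb{V}$ is the vector dual to $\alpha$ under the inner product. A $p$-form is simple if it can be written as a wedge product of $p$ one-forms. A nonzero simple form determines a $p$-plane, the span of those one-forms, regarded as a subspace $\Pi\subset\mathbb{V}$ using the inner product to identify $\mathbb{V}^*$ with $\mathbb{V}$. Two nonzero simple $p$-forms are orthogonal if their planes satisfy $\langle X_1,X_2\rangle=0$ for all $X_1\in\Pi_1$, $X_2\in\Pi_2$. The zero form counts as simple and as orthogonal to every simple form (so $F$ simple is allowed as a degenerate case). *)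

theory Defs
  imports "HOL-Analysis.Analysis"
begin

text \<open>
  An element of the exterior algebra of the dual space is represented by its values on tuples of
  vectors, i.e. by a function on lists; a \<open>p\<close>-form vanishes on lists of length other than \<open>p\<close>.
  One-forms occurring as factors of a wedge product are given as linear functionals.
\<close>

type_synonym 'a form = "'a list \<Rightarrow> real"

abbreviation zero_form :: "'a form"
  where "zero_form \<equiv> (\<lambda>_. 0)"

definition forms :: "nat \<Rightarrow> 'a::real_vector form set"
  where "forms p = {\<Omega>. (\<forall>vs. length vs \<noteq> p \<longrightarrow> \<Omega> vs = 0) \<and>
                        (\<forall>us ws. linear (\<lambda>x. \<Omega> (us @ x # ws))) \<and>
                        (\<forall>vs. \<not> distinct vs \<longrightarrow> \<Omega> vs = 0)}"

definition contract :: "'a \<Rightarrow> 'a form \<Rightarrow> 'a form"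
  where "contract X \<Omega> = (\<lambda>vs. \<Omega> (X # vs))"

text \<open>
  The wedge product of a one-form with a form, normalised so that
  \<open>(\<alpha> \<and> \<beta>)(X, Y) = \<alpha>(X) \<beta>(Y) - \<alpha>(Y) \<beta>(X)\<close>.
\<close>

definition wedge :: "('a \<Rightarrow> real) \<Rightarrow> 'a form \<Rightarrow> 'a form"
  where "wedge \<alpha> \<Omega> =
    (\<lambda>vs. \<Sum>i<length vs. (-1) ^ i * \<alpha> (vs ! i) * \<Omega> (take i vs @ drop (Suc i) vs))"

definition unit_form :: "'a form"
  where "unit_form vs = (if vs = [] then 1 else 0)"

definition wedge_list :: "('a \<Rightarrow> real) list \<Rightarrow> 'a form"
  where "wedge_list \<alpha>s = foldr wedge \<alpha>s unit_form"

definition sharp :: "('a::euclidean_space \<Rightarrow> real) \<Rightarrow> 'a"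
  where "sharp \<alpha> = (THE v. \<forall>x. v \<bullet> x = \<alpha> x)"

text \<open>
  The action of a decomposable 2-form, and its linear extension by means of
  \<open>\<omega> = 1/2 \<Sum>b c. \<omega>(b, c) b\<^sup>* \<and> c\<^sup>*\<close>, where \<open>b\<close>, \<open>c\<close> range over an orthonormal basis. Lemmas
  \<open>bracket_wedge\<close>, \<open>bracket_add\<close>, \<open>bracket_scale\<close> and \<open>two_form_expansion\<close> below show that this is
  the unique linear extension.
\<close>

definition bracket_decomp ::
    "('a::euclidean_space \<Rightarrow> real) \<Rightarrow> ('a \<Rightarrow> real) \<Rightarrow> 'a form \<Rightarrow> 'a form"
  where "bracket_decomp \<alpha> \<beta> \<Omega> =
    (\<lambda>vs. wedge \<alpha> (contract (sharp \<beta>) \<Omega>) vs - wedge \<beta> (contract (sharp \<alpha>) \<Omega>) vs)"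

definition bracket :: "'a::euclidean_space form \<Rightarrow> 'a form \<Rightarrow> 'a form"
  where "bracket \<omega> \<Omega> =
    (\<lambda>vs. (1/2) * (\<Sum>b\<in>Basis. \<Sum>c\<in>Basis. \<omega> [b, c] * bracket_decomp (inner b) (inner c) \<Omega> vs))"

definition simple_factors :: "nat \<Rightarrow> 'a::real_vector form \<Rightarrow> ('a \<Rightarrow> real) list \<Rightarrow> bool"
  where "simple_factors p \<Omega> \<alpha>s \<longleftrightarrow>
    length \<alpha>s = p \<and> (\<forall>\<alpha>\<in>set \<alpha>s. linear \<alpha>) \<and> \<Omega> = wedge_list \<alpha>s"

definition simple_form :: "nat \<Rightarrow> 'a::real_vector form \<Rightarrow> bool"
  where "simple_form p \<Omega> \<longleftrightarrow> (\<exists>\<alpha>s. simple_factors p \<Omega> \<alpha>s)"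

text \<open>
  The plane of a nonzero simple form does not depend on the chosen factors, see \<open>form_plane_eq\<close>.
\<close>

definition form_plane :: "nat \<Rightarrow> 'a::euclidean_space form \<Rightarrow> 'a set"
  where "form_plane p \<Omega> = (THE P. \<exists>\<alpha>s. simple_factors p \<Omega> \<alpha>s \<and> P = span (sharp ` set \<alpha>s))"

definition orthogonal_forms ::
    "nat \<Rightarrow> 'a::euclidean_space form \<Rightarrow> 'a form \<Rightarrow> bool"
  where "orthogonal_forms p \<Omega>1 \<Omega>2 \<longleftrightarrow>
    \<Omega>1 = zero_form \<or> \<Omega>2 = zero_form \<or>
    (\<forall>X1\<in>form_plane p \<Omega>1. \<forall>X2\<in>form_plane p \<Omega>2. X1 \<bullet> X2 = 0)"


lemma sharp_inner:
  assumes "linear \<alpha>"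
  shows "sharp \<alpha> \<bullet> x = \<alpha> x"
proof -
  have ex: "\<forall>x. (\<Sum>b\<in>Basis. \<alpha> b *\<^sub>R b) \<bullet> x = \<alpha> x"
  proof
    fix x
    have "\<alpha> x = \<alpha> (\<Sum>b\<in>Basis. (x \<bullet> b) *\<^sub>R b)" by (simp add: euclidean_representation)
    also have "\<dots> = (\<Sum>b\<in>Basis. (x \<bullet> b) * \<alpha> b)"
      using assms by (simp add: linear_sum linear_scale)
    finally show "(\<Sum>b\<in>Basis. \<alpha> b *\<^sub>R b) \<bullet> x = \<alpha> x"
      by (subst inner_sum_left) (simp add: inner_commute mult.commute)
  qed
  have "\<forall>x. sharp \<alpha> \<bullet> x = \<alpha> x"
    unfolding sharp_def
  proof (rule theI[where P = "\<lambda>v. \<forall>x. v \<bullet> x = \<alpha> x", OF ex])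
    fix v assume "\<forall>x. v \<bullet> x = \<alpha> x"
    then show "v = (\<Sum>b\<in>Basis. \<alpha> b *\<^sub>R b)"
      using ex by (metis vector_eq_rdot)
  qed
  then show ?thesis by blast
qed

lemma sharp_inner_eq [simp]: "sharp (inner b) = b"
proof -
  have "linear (inner b)" by (simp add: bounded_linear.linear bounded_linear_inner_right)
  then show ?thesis by (metis sharp_inner vector_eq_rdot)
qed

lemma sharp_expansion:
  assumes "linear \<alpha>"
  shows "sharp \<alpha> = (\<Sum>b\<in>Basis. \<alpha> b *\<^sub>R b)"
  using euclidean_representation[of "sharp \<alpha>"] by (simp add: sharp_inner[OF assms])

lemma wedge_Nil [simp]: "wedge \<alpha> \<Omega> [] = 0"
  by (simp add: wedge_def)

lemma wedge_Cons: "wedge \<alpha> \<Omega> (v # vs) = \<alpha> v * \<Omega> vs - wedge \<alpha> (contract v \<Omega>) vs"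
  by (simp add: wedge_def contract_def sum.lessThan_Suc_shift sum_negf[symmetric] del: sum.lessThan_Suc)

lemma contract_wedge:
  "contract v (wedge \<alpha> \<Omega>) = (\<lambda>vs. \<alpha> v * \<Omega> vs - wedge \<alpha> (contract v \<Omega>) vs)"
  by (simp add: contract_def[of _ "wedge \<alpha> \<Omega>"] wedge_Cons)

lemma wedge_diff: "wedge \<alpha> (\<lambda>vs. \<Omega> vs - \<Psi> vs) vs = wedge \<alpha> \<Omega> vs - wedge \<alpha> \<Psi> vs"
  by (simp add: wedge_def sum_subtractf algebra_simps)

lemma wedge_scale: "wedge \<alpha> (\<lambda>vs. c * \<Omega> vs) vs = c * wedge \<alpha> \<Omega> vs"
  by (simp add: wedge_def sum_distrib_left algebra_simps)

lemma wedge_zero [simp]: "wedge \<alpha> zero_form = zero_form"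
  by (simp add: wedge_def fun_eq_iff)

lemma wedge_sum_right: "wedge \<alpha> (\<lambda>vs. \<Sum>b\<in>B. f b * \<Omega> b vs) vs = (\<Sum>b\<in>B. f b * wedge \<alpha> (\<Omega> b) vs)"
  unfolding wedge_def
  by (simp only: sum_distrib_left, subst sum.swap) (simp add: algebra_simps)

lemma wedge_sum_left: "wedge (\<lambda>x. \<Sum>b\<in>B. f b * \<alpha> b x) \<Omega> vs = (\<Sum>b\<in>B. f b * wedge (\<alpha> b) \<Omega> vs)"
  unfolding wedge_def
  by (simp only: sum_distrib_left sum_distrib_right, subst sum.swap) (simp add: algebra_simps)

lemma wedge_anticommute: "wedge \<alpha> (wedge \<beta> \<Omega>) vs = - wedge \<beta> (wedge \<alpha> \<Omega>) vs"
proof (induction vs arbitrary: \<Omega>)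
  case Nil
  then show ?case by simp
next
  case (Cons v vs)
  show ?case
    using Cons.IH[of "contract v \<Omega>"]
    by (simp add: wedge_Cons contract_wedge wedge_diff wedge_scale)
qed

lemma wedge_wedge_same [simp]: "wedge \<alpha> (wedge \<alpha> \<Omega>) = zero_form"
  using wedge_anticommute[of \<alpha> \<alpha> \<Omega>] by (simp add: fun_eq_iff)

lemma wedge_list_Nil [simp]: "wedge_list [] = unit_form"
  and wedge_list_Cons [simp]: "wedge_list (\<alpha> # \<alpha>s) = wedge \<alpha> (wedge_list \<alpha>s)"
  by (simp_all add: wedge_list_def)

lemma wedge_factor: "\<alpha> \<in> set \<alpha>s \<Longrightarrow> wedge \<alpha> (wedge_list \<alpha>s) = zero_form"
proof (induction \<alpha>s)
  case Nil
  then show ?case by simp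
next
  case (Cons \<beta> \<alpha>s)
  show ?case
  proof (cases "\<alpha> = \<beta>")
    case False
    then have "wedge \<alpha> (wedge_list \<alpha>s) = zero_form" using Cons by simp
    then have "wedge \<beta> (wedge \<alpha> (wedge_list \<alpha>s)) = zero_form" by simp
    then show ?thesis using wedge_anticommute[of \<alpha> \<beta> "wedge_list \<alpha>s"] by (simp add: fun_eq_iff)
  qed simp
qed

lemma contract_wedge_list:
  "(\<And>\<alpha>. \<alpha> \<in> set \<alpha>s \<Longrightarrow> \<alpha> X = 0) \<Longrightarrow> contract X (wedge_list \<alpha>s) = zero_form"
proof (induction \<alpha>s)
  case Nil
  then show ?case by (simp add: contract_def unit_form_def)
next
  case (Cons \<beta> \<alpha>s)
  then have "contract X (wedge_list \<alpha>s) = zero_form" and "\<beta> X = 0" by auto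
  then show ?case by (simp add: contract_wedge)
qed

lemma contract_wedge_list_iff:
  assumes "wedge_list \<alpha>s \<noteq> zero_form"
  shows "contract X (wedge_list \<alpha>s) = zero_form \<longleftrightarrow> (\<forall>\<alpha>\<in>set \<alpha>s. \<alpha> X = 0)"
proof
  assume 0: "contract X (wedge_list \<alpha>s) = zero_form"
  show "\<forall>\<alpha>\<in>set \<alpha>s. \<alpha> X = 0"
  proof
    fix \<alpha> assume "\<alpha> \<in> set \<alpha>s"
    from wedge_factor[OF this] have "contract X (wedge \<alpha> (wedge_list \<alpha>s)) = zero_form"
      by (simp add: contract_def)
    then have "\<forall>vs. \<alpha> X * wedge_list \<alpha>s vs = 0"
      unfolding contract_wedge 0 by (simp add: fun_eq_iff)
    with assms show "\<alpha> X = 0" by (auto simp: fun_eq_iff)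
  qed
qed (simp add: contract_wedge_list)

lemma span_sharp_eq:
  fixes \<alpha>s :: "('a::euclidean_space \<Rightarrow> real) list"
  assumes "wedge_list \<alpha>s \<noteq> zero_form" and "\<forall>\<alpha>\<in>set \<alpha>s. linear \<alpha>"
  shows "span (sharp ` set \<alpha>s) = orthogonal_comp {X. contract X (wedge_list \<alpha>s) = zero_form}"
proof -
  have "contract X (wedge_list \<alpha>s) = zero_form \<longleftrightarrow> X \<in> orthogonal_comp (span (sharp ` set \<alpha>s))" for X
  proof -
    have "contract X (wedge_list \<alpha>s) = zero_form \<longleftrightarrow> (\<forall>v\<in>sharp ` set \<alpha>s. orthogonal X v)"
      using assms(2) unfolding contract_wedge_list_iff[OF assms(1)]
      by (auto simp: orthogonal_def inner_commute[of X] sharp_inner)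
    also have "\<dots> \<longleftrightarrow> (\<forall>v\<in>span (sharp ` set \<alpha>s). orthogonal X v)"
      using orthogonal_to_span span_base by blast
    finally show ?thesis by (simp add: orthogonal_comp_def orthogonal_commute)
  qed
  then have "{X. contract X (wedge_list \<alpha>s) = zero_form} = orthogonal_comp (span (sharp ` set \<alpha>s))"
    by blast
  then show ?thesis by (simp add: orthogonal_comp_self)
qed

lemma form_plane_eq:
  assumes "simple_factors p \<Omega> \<alpha>s" and "\<Omega> \<noteq> zero_form"
  shows "form_plane p \<Omega> = span (sharp ` set \<alpha>s)"
proof -
  have eq: "span (sharp ` set \<beta>s) = orthogonal_comp {X. contract X \<Omega> = zero_form}"
    if "simple_factors p \<Omega> \<beta>s" for \<beta>s
    using that span_sharp_eq[of \<beta>s] assms(2) by (simp add: simple_factors_def)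
  show ?thesis
    unfolding form_plane_def
  proof (rule the_equality)
    show "\<exists>\<beta>s. simple_factors p \<Omega> \<beta>s \<and> span (sharp ` set \<alpha>s) = span (sharp ` set \<beta>s)"
      using assms(1) by blast
  next
    fix P assume "\<exists>\<beta>s. simple_factors p \<Omega> \<beta>s \<and> P = span (sharp ` set \<beta>s)"
    then show "P = span (sharp ` set \<alpha>s)" using eq[OF assms(1)] eq by auto
  qed
qed

lemma forms_length: "\<Omega> \<in> forms p \<Longrightarrow> length vs \<noteq> p \<Longrightarrow> \<Omega> vs = 0"
  and forms_linear: "\<Omega> \<in> forms p \<Longrightarrow> linear (\<lambda>x. \<Omega> (us @ x # ws))"
  and forms_alternating: "\<Omega> \<in> forms p \<Longrightarrow> \<not> distinct vs \<Longrightarrow> \<Omega> vs = 0"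
  by (auto simp: forms_def)

lemma forms_swap:
  assumes "\<Omega> \<in> forms p"
  shows "\<Omega> (us @ x # y # ws) = - \<Omega> (us @ y # x # ws)"
proof -
  have 1: "\<Omega> (us @ (a + b) # c # ws) = \<Omega> (us @ a # c # ws) + \<Omega> (us @ b # c # ws)" for a b c
    using linear_add[OF forms_linear[OF assms, of us "c # ws"]] by simp
  have 2: "\<Omega> (us @ c # (a + b) # ws) = \<Omega> (us @ c # a # ws) + \<Omega> (us @ c # b # ws)" for a b c
    using linear_add[OF forms_linear[OF assms, of "us @ [c]" ws]] by simp
  have 3: "\<Omega> (us @ c # c # ws) = 0" for c
    by (rule forms_alternating[OF assms]) simp
  show ?thesis using 3[of "x + y"] unfolding 1 2 by (simp add: 3)
qed

lemma contract_forms: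
  assumes "\<Omega> \<in> forms p"
  shows "contract v \<Omega> \<in> forms (p - 1)"
proof -
  have "linear (\<lambda>x. contract v \<Omega> (us @ x # ws))" for us ws
    using forms_linear[OF assms, of "v # us" ws] by (simp add: contract_def)
  then show ?thesis
    using forms_length[OF assms] forms_alternating[OF assms]
    by (auto simp: forms_def contract_def)
qed

lemma wedge_linear:
  assumes "linear \<alpha>" and "\<Omega> \<in> forms p"
  shows "linear (\<lambda>x. wedge \<alpha> \<Omega> (us @ x # ws))"
  using assms(2)
proof (induction us arbitrary: \<Omega> p)
  case Nil
  have 1: "contract (x + y) \<Omega> vs = contract x \<Omega> vs + contract y \<Omega> vs" for x y vs
    using linear_add[OF forms_linear[OF Nil, of "[]"]] by (simp add: contract_def)
  have 2: "contract (r *\<^sub>R x) \<Omega> vs = r * contract x \<Omega> vs" for r x vs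
    using linear_scale[OF forms_linear[OF Nil, of "[]"]] by (simp add: contract_def)
  have "wedge \<alpha> (contract (x + y) \<Omega>) ws
      = wedge \<alpha> (contract x \<Omega>) ws + wedge \<alpha> (contract y \<Omega>) ws" for x y
    unfolding wedge_def 1 by (simp add: algebra_simps sum.distrib)
  moreover have "wedge \<alpha> (contract (r *\<^sub>R x) \<Omega>) ws = r * wedge \<alpha> (contract x \<Omega>) ws" for r x
    unfolding wedge_def 2 by (simp add: algebra_simps sum_distrib_left)
  ultimately show ?case
    using assms(1)
    by (intro linearI) (simp_all add: wedge_Cons linear_add linear_scale algebra_simps)
next
  case (Cons u us)
  show ?case
    using linear_compose_sub[OF linear_compose_scale_right[OF forms_linear[OF Cons.prems, of us ws], of "\<alpha> u"]
        Cons.IH[OF contract_forms[OF Cons.prems, of u]]]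
    by (simp add: wedge_Cons)
qed

lemma wedge_swap:
  assumes "\<Omega> \<in> forms p"
  shows "wedge \<alpha> \<Omega> (us @ x # y # ws) = - wedge \<alpha> \<Omega> (us @ y # x # ws)"
  using assms
proof (induction us arbitrary: \<Omega> p)
  case Nil
  have "contract x (contract y \<Omega>) = (\<lambda>vs. (-1) * contract y (contract x \<Omega>) vs)"
  proof
    fix vs
    show "contract x (contract y \<Omega>) vs = (-1) * contract y (contract x \<Omega>) vs"
      using forms_swap[OF Nil, of "[]" y x vs] by (simp add: contract_def)
  qed
  then have "wedge \<alpha> (contract x (contract y \<Omega>)) ws = (-1) * wedge \<alpha> (contract y (contract x \<Omega>)) ws"
    by (simp only: wedge_scale)
  then show ?case by (simp add: wedge_Cons contract_wedge contract_def)
next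
  case (Cons u us)
  have "\<Omega> (us @ x # y # ws) = - \<Omega> (us @ y # x # ws)"
    and "wedge \<alpha> (contract u \<Omega>) (us @ x # y # ws) = - wedge \<alpha> (contract u \<Omega>) (us @ y # x # ws)"
    using forms_swap[OF Cons.prems] Cons.IH[OF contract_forms[OF Cons.prems]] by blast+
  then show ?case by (simp add: wedge_Cons)
qed

lemma wedge_forms:
  assumes "linear \<alpha>" and "\<Omega> \<in> forms p"
  shows "wedge \<alpha> \<Omega> \<in> forms (Suc p)"
proof -
  have 0: "wedge \<alpha> \<Omega> (us @ v # ms @ v # ws) = 0" for us v ms ws
  proof (induction ms arbitrary: us)
    case Nil
    then show ?case using wedge_swap[OF assms(2), of \<alpha> us v v ws] by simp
  next
    case (Cons m ms)
    then show ?case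
      using wedge_swap[OF assms(2), of \<alpha> us v m "ms @ v # ws"] Cons.IH[of "us @ [m]"] by simp
  qed
  have "wedge \<alpha> \<Omega> vs = 0" if "\<not> distinct vs" for vs
    using not_distinct_decomp[OF that] 0 by auto
  moreover have "wedge \<alpha> \<Omega> vs = 0" if "length vs \<noteq> Suc p" for vs
    unfolding wedge_def using that
    by (intro sum.neutral) (auto simp: forms_length[OF assms(2)])
  ultimately show ?thesis
    using wedge_linear[OF assms] by (auto simp: forms_def)
qed

lemma unit_forms: "unit_form \<in> forms 0"
proof -
  have "unit_form (us @ x # ws) = 0" for us ws and x :: 'a
    by (simp add: unit_form_def)
  then show ?thesis by (auto simp: forms_def unit_form_def linear_iff)
qed

lemma simple_form_forms: "simple_form p \<Omega> \<Longrightarrow> \<Omega> \<in> forms p"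
proof -
  have "\<forall>\<alpha>\<in>set \<alpha>s. linear \<alpha> \<Longrightarrow> wedge_list \<alpha>s \<in> forms (length \<alpha>s)" for \<alpha>s :: "('a \<Rightarrow> real) list"
    by (induction \<alpha>s) (auto simp: unit_forms wedge_forms)
  then show "simple_form p \<Omega> \<Longrightarrow> \<Omega> \<in> forms p"
    by (auto simp: simple_form_def simple_factors_def)
qed

lemma simple_zero_form:
  assumes "p > 0"
  shows "simple_form p (zero_form :: 'a::real_vector form)"
proof -
  have "wedge_list (replicate p (\<lambda>x::'a. 0)) = zero_form"
    using assms by (cases p) (simp_all add: wedge_def)
  moreover have "linear (\<lambda>x::'a. 0::real)" by (simp add: linear_iff)
  ultimately show ?thesis
    unfolding simple_form_def simple_factors_def
    by (intro exI[of _ "replicate p (\<lambda>x::'a. 0)"]) auto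
qed

lemma linear_inner: "linear (inner b)"
  by (simp add: bounded_linear.linear bounded_linear_inner_right)

lemma wedge_list_2: "wedge_list [\<alpha>, \<beta>] [x, y] = \<alpha> x * \<beta> y - \<alpha> y * \<beta> x"
  by (simp add: wedge_Cons contract_wedge contract_def unit_form_def wedge_diff wedge_scale)

lemma linear_Basis_expansion:
  fixes f :: "'a::euclidean_space \<Rightarrow> real"
  assumes "linear f"
  shows "f x = (\<Sum>b\<in>Basis. (b \<bullet> x) * f b)"
proof -
  have "f x = f (\<Sum>b\<in>Basis. (x \<bullet> b) *\<^sub>R b)" by (simp add: euclidean_representation)
  then show ?thesis using assms by (simp add: linear_sum linear_scale inner_commute)
qed

lemma two_form_expansion:
  fixes \<omega> :: "'a::euclidean_space form"
  assumes "\<omega> \<in> forms 2"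
  shows "\<omega> vs = (1/2) * (\<Sum>b\<in>Basis. \<Sum>c\<in>Basis. \<omega> [b, c] * wedge_list [inner b, inner c] vs)"
proof (cases "length vs = 2")
  case True
  then obtain x y where vs: "vs = [x, y]"
    by (auto simp: numeral_2_eq_2 length_Suc_conv)
  have e: "\<omega> [x, y] = (\<Sum>b\<in>Basis. \<Sum>c\<in>Basis. \<omega> [b, c] * ((b \<bullet> x) * (c \<bullet> y)))" for x y
  proof -
    have "\<omega> [x, y] = (\<Sum>b\<in>Basis. (b \<bullet> x) * \<omega> [b, y])"
      using linear_Basis_expansion[OF forms_linear[OF assms, of "[]" "[y]"], of x]
      by (simp only: append_Nil)
    also have "\<dots> = (\<Sum>b\<in>Basis. (b \<bullet> x) * (\<Sum>c\<in>Basis. (c \<bullet> y) * \<omega> [b, c]))"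
    proof (rule sum.cong[OF refl])
      fix b :: 'a
      have "\<omega> [b, y] = (\<Sum>c\<in>Basis. (c \<bullet> y) * \<omega> [b, c])"
        using linear_Basis_expansion[OF forms_linear[OF assms, of "[b]" "[]"], of y]
        by (simp only: append_Cons append_Nil)
      then show "(b \<bullet> x) * \<omega> [b, y] = (b \<bullet> x) * (\<Sum>c\<in>Basis. (c \<bullet> y) * \<omega> [b, c])"
        by (simp only:)
    qed
    finally show ?thesis by (simp add: sum_distrib_left algebra_simps)
  qed
  have "\<omega> [y, x] = - \<omega> [x, y]"
    using forms_swap[OF assms, of "[]" y x "[]"] by simp
  then have "\<omega> [x, y] = (1/2) * (\<omega> [x, y] - \<omega> [y, x])" by simp
  also have "\<omega> [x, y] - \<omega> [y, x] =
      (\<Sum>b\<in>Basis. \<Sum>c\<in>Basis. \<omega> [b, c] * wedge_list [inner b, inner c] [x, y])"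
    unfolding wedge_list_2 e[of x y] e[of y x]
    by (simp only: sum_subtractf[symmetric] right_diff_distrib)
  finally show ?thesis by (simp only: vs)
next
  case False
  have "wedge_list [inner b, inner c] \<in> forms 2" for b c :: 'a
    by (rule simple_form_forms)
      (auto simp: simple_form_def simple_factors_def linear_inner simp del: wedge_list_Cons
            intro!: exI[of _ "[inner b, inner c]"])
  then have "wedge_list [inner b, inner c] vs = 0" for b c :: 'a
    using False forms_length by blast
  then show ?thesis
    using False forms_length[OF assms] by (simp del: wedge_list_Cons)
qed

lemma bracket_add: "bracket (\<lambda>vs. \<omega> vs + \<omega>' vs) \<Omega> = (\<lambda>vs. bracket \<omega> \<Omega> vs + bracket \<omega>' \<Omega> vs)"
  by (simp add: bracket_def algebra_simps sum.distrib add_divide_distrib)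

lemma bracket_scale: "bracket (\<lambda>vs. r * \<omega> vs) \<Omega> = (\<lambda>vs. r * bracket \<omega> \<Omega> vs)"
  by (simp add: bracket_def sum_distrib_left algebra_simps)

lemma bracket_wedge:
  fixes \<Omega> :: "'a::euclidean_space form"
  assumes \<alpha>: "linear \<alpha>" and \<beta>: "linear \<beta>" and \<Omega>: "\<Omega> \<in> forms p"
  shows "bracket (wedge_list [\<alpha>, \<beta>]) \<Omega> = bracket_decomp \<alpha> \<beta> \<Omega>"
proof
  fix vs
  define T where "T b c = wedge (inner b) (contract c \<Omega>) vs" for b c
  have T: "wedge \<gamma> (contract (sharp \<delta>) \<Omega>) vs = (\<Sum>b\<in>Basis. \<Sum>c\<in>Basis. \<gamma> b * \<delta> c * T b c)"
    if "linear \<gamma>" and "linear \<delta>" for \<gamma> \<delta>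
  proof -
    have g: "\<gamma> = (\<lambda>x. \<Sum>b\<in>Basis. \<gamma> b * inner b x)"
      by (rule ext, subst linear_Basis_expansion[OF that(1)]) (simp add: mult.commute)
    have "contract (sharp \<delta>) \<Omega> us = (\<Sum>c\<in>Basis. \<delta> c * contract c \<Omega> us)" for us
    proof -
      have "linear (\<lambda>x. contract x \<Omega> us)"
        using forms_linear[OF \<Omega>, of "[]" us] by (simp add: contract_def)
      from linear_sum[OF this, of "\<lambda>c. \<delta> c *\<^sub>R c" Basis] linear_scale[OF this]
      show ?thesis by (simp add: sharp_expansion[OF that(2)])
    qed
    then have d: "contract (sharp \<delta>) \<Omega> = (\<lambda>us. \<Sum>c\<in>Basis. \<delta> c * contract c \<Omega> us)" by blast
    have "wedge \<gamma> (contract (sharp \<delta>) \<Omega>) vs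
        = (\<Sum>b\<in>Basis. \<gamma> b * wedge (inner b) (contract (sharp \<delta>) \<Omega>) vs)"
      by (subst g) (rule wedge_sum_left)
    also have "\<dots> = (\<Sum>b\<in>Basis. \<gamma> b * (\<Sum>c\<in>Basis. \<delta> c * T b c))"
      unfolding d wedge_sum_right T_def ..
    finally show ?thesis by (simp add: sum_distrib_left mult.assoc)
  qed
  have swap: "(\<Sum>b\<in>Basis. \<Sum>c\<in>Basis. \<gamma> b * \<delta> c * T c b) = (\<Sum>b\<in>Basis. \<Sum>c\<in>Basis. \<delta> b * \<gamma> c * T b c)"
    for \<gamma> \<delta> :: "'a \<Rightarrow> real"
    by (subst sum.swap) (simp add: mult.commute)
  have "bracket (wedge_list [\<alpha>, \<beta>]) \<Omega> vs
      = (1/2) * (\<Sum>b\<in>Basis. \<Sum>c\<in>Basis. (\<alpha> b * \<beta> c - \<alpha> c * \<beta> b) * (T b c - T c b))"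
    unfolding bracket_def bracket_decomp_def wedge_list_2 sharp_inner_eq T_def ..
  also have "\<dots> = (1/2) *
      ((\<Sum>b\<in>Basis. \<Sum>c\<in>Basis. \<alpha> b * \<beta> c * T b c) - (\<Sum>b\<in>Basis. \<Sum>c\<in>Basis. \<alpha> b * \<beta> c * T c b)
      - ((\<Sum>b\<in>Basis. \<Sum>c\<in>Basis. \<beta> b * \<alpha> c * T b c) - (\<Sum>b\<in>Basis. \<Sum>c\<in>Basis. \<beta> b * \<alpha> c * T c b)))"
    by (simp only: sum_subtractf[symmetric]) (simp add: algebra_simps)
  also have "\<dots> = (\<Sum>b\<in>Basis. \<Sum>c\<in>Basis. \<alpha> b * \<beta> c * T b c) - (\<Sum>b\<in>Basis. \<Sum>c\<in>Basis. \<beta> b * \<alpha> c * T b c)"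
    unfolding swap by simp
  also have "\<dots> = bracket_decomp \<alpha> \<beta> \<Omega> vs"
    unfolding bracket_decomp_def T[OF \<alpha> \<beta>] T[OF \<beta> \<alpha>] ..
  finally show "bracket (wedge_list [\<alpha>, \<beta>]) \<Omega> vs = bracket_decomp \<alpha> \<beta> \<Omega> vs" .
qed

end

theory Submission
  imports Defs
begin

text \<open>
  Define a bracket by \<open>[x, y] \<bullet> z = F(x, y, z)\<close>. Then \<open>[\<iota>\<^sub>X F, F] = 0\<close> for all \<open>X\<close> is the
  Jacobi identity, so the space becomes a Lie algebra with an invariant euclidean inner product. If
  \<open>F \<noteq> 0\<close>, unit vectors \<open>e1\<close>, \<open>e2\<close> maximizing \<open>|[e1, e2]|\<close> span together with their bracket a copy
  \<open>S\<close> of \<open>su(2)\<close>, and maximality leaves for the complement only the weights \<open>0\<close> and \<open>\<plusminus>1/2\<close> of \<open>S\<close>.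
  Weight \<open>1/2\<close> would fill the remaining four dimensions with one quaternionic line, on which the
  Jacobi identity fails. Hence \<open>S\<close> is an ideal, and the same choice of a maximizing pair in its
  complement yields the second simple form, because the one dimension that is then left is central.
\<close>

section \<open>Lie algebras with an invariant euclidean inner product\<close>

text \<open>This is the equality case of Cauchy-Schwarz: skewness gives
  \<open>T (T v) \<bullet> v = - (norm (T v))\<^sup>2\<close>, so expanding the square of
  \<open>norm (T (T v) + \<mu>\<^sup>2 *\<^sub>R v)\<close> and inserting the bound leaves at most
  0.\<close>

lemma skew_maximizer_eigenvector:
  fixes T :: "'a::real_inner \<Rightarrow> 'a"
  assumes skew: "\<And>x y. T x \<bullet> y = - (x \<bullet> T y)"
    and bound: "norm (T (T v)) \<le> \<mu> * norm (T v)"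
    and max: "norm (T v) = \<mu> * norm v"
  shows "T (T v) = - (\<mu>\<^sup>2 *\<^sub>R v)"
proof -
  have 1: "T (T v) \<bullet> v = - (norm (T v))\<^sup>2"
    using skew[of "T v" v] by (simp add: power2_norm_eq_inner)
  have 2: "(norm (T (T v)))\<^sup>2 \<le> \<mu>\<^sup>2 * (norm (T v))\<^sup>2"
    using power_mono[OF bound norm_ge_zero, of 2] by (simp add: power_mult_distrib)
  have "(norm (T (T v) + \<mu>\<^sup>2 *\<^sub>R v))\<^sup>2 =
      (norm (T (T v)))\<^sup>2 + 2 * \<mu>\<^sup>2 * (T (T v) \<bullet> v) + \<mu>\<^sup>2 * \<mu>\<^sup>2 * (norm v)\<^sup>2"
    by (simp add: power2_norm_eq_inner inner_add_left inner_add_right inner_commute algebra_simps)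
  also have "\<dots> \<le> \<mu>\<^sup>2 * (norm (T v))\<^sup>2 - 2 * \<mu>\<^sup>2 * (norm (T v))\<^sup>2 + \<mu>\<^sup>2 * (norm (T v))\<^sup>2"
    using 2 unfolding 1 max by (simp add: power_mult_distrib)
  finally have "norm (T (T v) + \<mu>\<^sup>2 *\<^sub>R v) = 0" by simp
  then show ?thesis by (simp add: eq_neg_iff_add_eq_0)
qed

text \<open>Carries the dimension counts. With a list in place of a set, eight vectors count as
  eight without a separate proof that they are distinct.\<close>

lemma length_orthogonal_le_DIM:
  fixes vs :: "'a::euclidean_space list"
  assumes "sorted_wrt orthogonal vs" and "0 \<notin> set vs"
  shows "length vs \<le> DIM('a)"
proof -
  have ne: "orthogonal (vs ! i) (vs ! j)" if "i < length vs" "j < length vs" "i \<noteq> j" for i j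
    using that assms(1) by (metis nat_neq_iff orthogonal_commute sorted_wrt_nth_less)
  have d: "distinct vs"
    unfolding distinct_conv_nth
    using ne assms(2) by (metis nth_mem orthogonal_self)
  have "pairwise orthogonal (set vs)"
    using ne by (fastforce simp: pairwise_def in_set_conv_nth)
  then have "independent (set vs)"
    using pairwise_orthogonal_independent assms(2) by blast
  then have "card (set vs) \<le> DIM('a)"
    using independent_bound by blast
  then show ?thesis using d by (simp add: distinct_card)
qed

text \<open>
  Determined by \<open>wedge_bracket a b c x y \<bullet> z = (a \<and> b \<and> c)(x, y, z)\<close>.
\<close>

definition wedge_bracket :: "'a::real_inner \<Rightarrow> 'a \<Rightarrow> 'a \<Rightarrow> 'a \<Rightarrow> 'a \<Rightarrow> 'a"
  where "wedge_bracket a b c x y =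
    ((b \<bullet> x) * (c \<bullet> y) - (c \<bullet> x) * (b \<bullet> y)) *\<^sub>R a +
    ((c \<bullet> x) * (a \<bullet> y) - (a \<bullet> x) * (c \<bullet> y)) *\<^sub>R b +
    ((a \<bullet> x) * (b \<bullet> y) - (b \<bullet> x) * (a \<bullet> y)) *\<^sub>R c"

locale metric_lie_algebra =
  fixes br :: "'a::euclidean_space \<Rightarrow> 'a \<Rightarrow> 'a"
  assumes bilinear: "bilinear br"
    and anticommute: "br y x = - br x y"
    and invariant: "br x y \<bullet> z = x \<bullet> br y z"
    and jacobi: "br x (br y z) = br (br x y) z + br y (br x z)"
begin

lemmas br_simps =
  bilinear_ladd[OF bilinear] bilinear_radd[OF bilinear]
  bilinear_lmul[OF bilinear] bilinear_rmul[OF bilinear]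
  bilinear_lneg[OF bilinear] bilinear_rneg[OF bilinear]
  bilinear_lsub[OF bilinear] bilinear_rsub[OF bilinear]
  bilinear_lzero[OF bilinear] bilinear_rzero[OF bilinear]

lemma br_self [simp]: "br x x = 0"
  using anticommute[of x x] by (simp add: eq_neg_iff_add_eq_0 scaleR_2[symmetric])

lemma br_skew: "br e x \<bullet> y = - (x \<bullet> br e y)"
  using invariant[of x e y] anticommute[of e x] by (simp add: inner_minus_left)

lemma br_inner_self [simp]: "br x y \<bullet> x = 0" "br x y \<bullet> y = 0"
  using invariant[of y x x] invariant[of x y y] anticommute[of x y] by simp_all

lemma br_inner_cycle: "br x y \<bullet> z = br y z \<bullet> x"
  using invariant[of x y z] by (simp add: inner_commute)

text \<open>\<open>br e\<close> is a skew derivation, so it annihilates the invariant trilinear form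
  \<open>br x y \<bullet> z\<close>.\<close>

lemma br_inner_derivation: "br (br e x) y \<bullet> z + br x (br e y) \<bullet> z + br x y \<bullet> br e z = 0"
  using br_skew[of e "br x y" z] jacobi[of e x y] by (simp add: inner_add_left)

text \<open>The Jacobi identity is homogeneous of degree two in the bracket. This lets the maximal
  value \<kappa> be normalised to 1.\<close>

lemma scale: "metric_lie_algebra (\<lambda>x y. c *\<^sub>R br x y)"
proof
  show "bilinear (\<lambda>x y. c *\<^sub>R br x y)"
    by (auto simp: bilinear_def linear_iff br_simps scaleR_add_right mult.commute)
  show "c *\<^sub>R br y x = - (c *\<^sub>R br x y)" for x y using anticommute[of y x] by simp
  show "c *\<^sub>R br x y \<bullet> z = x \<bullet> c *\<^sub>R br y z" for x y z by (simp add: invariant)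
  show "c *\<^sub>R br x (c *\<^sub>R br y z) = c *\<^sub>R br (c *\<^sub>R br x y) z + c *\<^sub>R br y (c *\<^sub>R br x z)" for x y z
    by (simp add: br_simps jacobi[of x y z] scaleR_add_right)
qed

text \<open>
  If \<open>|br x y|\<close> is maximal among unit vectors, then \<open>x\<close> and \<open>y\<close> generate a copy of \<open>su(2)\<close>.
\<close>

lemma maximal_triple:
  assumes W: "subspace W" and closed: "\<And>x y. x \<in> W \<Longrightarrow> y \<in> W \<Longrightarrow> br x y \<in> W"
    and nz: "x0 \<in> W" "y0 \<in> W" "br x0 y0 \<noteq> 0"
  obtains \<kappa> e1 e2 e3 where "\<kappa> > 0" "e1 \<in> W" "e2 \<in> W" "e3 \<in> W"
    "norm e1 = 1" "norm e2 = 1" "norm e3 = 1"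
    "e1 \<bullet> e2 = 0" "e2 \<bullet> e3 = 0" "e3 \<bullet> e1 = 0"
    "br e1 e2 = \<kappa> *\<^sub>R e3" "br e2 e3 = \<kappa> *\<^sub>R e1" "br e3 e1 = \<kappa> *\<^sub>R e2"
    "\<And>x y. x \<in> W \<Longrightarrow> y \<in> W \<Longrightarrow> norm (br x y) \<le> \<kappa> * norm x * norm y"
proof -
  let ?S = "W \<inter> sphere 0 1"
  have unit: "inverse (norm x) *\<^sub>R x \<in> ?S" if "x \<in> W" "x \<noteq> 0" for x
    using that W by (simp add: subspace_scale)
  have "x0 \<noteq> 0" "y0 \<noteq> 0" using nz(3) by (auto simp: br_simps)
  have cpt: "compact (?S \<times> ?S)"
    using closed_subspace[OF W] by (intro compact_Times closed_Int_compact) auto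
  have ne: "?S \<times> ?S \<noteq> {}"
    using unit[OF nz(1) \<open>x0 \<noteq> 0\<close>] by blast
  have bb: "bounded_bilinear br" using bilinear by (simp add: bilinear_conv_bounded_bilinear)
  have cont: "continuous_on (?S \<times> ?S) (\<lambda>p. norm (br (fst p) (snd p)))"
    by (intro continuous_intros bounded_bilinear.continuous_on[OF bb])
  obtain p where p: "p \<in> ?S \<times> ?S"
    and pm: "\<And>q. q \<in> ?S \<times> ?S \<Longrightarrow> norm (br (fst q) (snd q)) \<le> norm (br (fst p) (snd p))"
    using continuous_attains_sup[OF cpt ne cont] by blast
  define e1 e2 \<kappa> where "e1 = fst p" and "e2 = snd p" and "\<kappa> = norm (br e1 e2)"
  have e: "e1 \<in> W" "e2 \<in> W" "norm e1 = 1" "norm e2 = 1" using p by (auto simp: e1_def e2_def)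
  have bound: "norm (br x y) \<le> \<kappa> * norm x * norm y" if xy: "x \<in> W" "y \<in> W" for x y
  proof (cases "x = 0 \<or> y = 0")
    case True
    then show ?thesis by (auto simp: br_simps)
  next
    case False
    have "(inverse (norm x) *\<^sub>R x, inverse (norm y) *\<^sub>R y) \<in> ?S \<times> ?S"
      using False xy unit by blast
    from pm[OF this] False show ?thesis
      by (simp add: br_simps \<kappa>_def e1_def e2_def field_simps)
  qed
  have pos: "\<kappa> > 0"
  proof (rule ccontr)
    assume "\<not> \<kappa> > 0"
    then have "\<kappa> = 0" by (simp add: \<kappa>_def)
    then show False using bound[OF nz(1,2)] nz(3) by simp
  qed
  \<comment> \<open>Maximality over both arguments bounds \<open>br e1\<close> on \<open>W\<close>
    by \<kappa>, and \<open>e2\<close> attains this bound; \<open>m2\<close> exchanges the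
    roles.\<close>
  have m1: "br e1 (br e1 e2) = - (\<kappa>\<^sup>2 *\<^sub>R e2)"
    by (rule skew_maximizer_eigenvector[OF br_skew])
      (use bound[of e1 "br e1 e2"] closed e in \<open>simp_all add: \<kappa>_def\<close>)
  have n21: "norm (br e2 e1) = \<kappa>" using anticommute[of e2 e1] by (simp add: \<kappa>_def)
  have m2: "br e2 (br e2 e1) = - (\<kappa>\<^sup>2 *\<^sub>R e1)"
    by (rule skew_maximizer_eigenvector[OF br_skew])
      (use bound[of e2 "br e2 e1"] closed e n21 in simp_all)
  define e3 where "e3 = inverse \<kappa> *\<^sub>R br e1 e2"
  \<comment> \<open>The pair was not chosen orthogonal. By \<open>m2\<close>, \<open>e1\<close> is a
    multiple of a bracket with \<open>e2\<close>, hence orthogonal to \<open>e2\<close>.\<close>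
  have "br e2 (br e2 e1) \<bullet> e2 = 0" by simp
  then have o12: "e1 \<bullet> e2 = 0" using pos unfolding m2 by simp
  have a3: "br e1 e2 = \<kappa> *\<^sub>R e3" using pos by (simp add: e3_def)
  have "\<kappa> *\<^sub>R br e2 e3 = br e2 (br e1 e2)" by (simp add: a3 br_simps)
  also have "\<dots> = \<kappa> *\<^sub>R (\<kappa> *\<^sub>R e1)"
    using m2 anticommute[of e2 e1] by (simp add: br_simps power2_eq_square)
  finally have a1: "br e2 e3 = \<kappa> *\<^sub>R e1" using pos by (simp only: scaleR_cancel_left) simp
  have "\<kappa> *\<^sub>R br e1 e3 = br e1 (br e1 e2)" by (simp add: a3 br_simps)
  also have "\<dots> = \<kappa> *\<^sub>R (- (\<kappa> *\<^sub>R e2))" using m1 by (simp add: power2_eq_square)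
  finally have "br e1 e3 = - (\<kappa> *\<^sub>R e2)" using pos by (simp only: scaleR_cancel_left) simp
  then have a2: "br e3 e1 = \<kappa> *\<^sub>R e2" using anticommute[of e3 e1] by simp
  show ?thesis
  proof (rule that[OF pos e(1,2) _ e(3,4) _ o12 _ _ a3 a1 a2 bound])
    show "e3 \<in> W" unfolding e3_def using W closed e by (simp add: subspace_scale)
    show "norm e3 = 1" using pos by (simp add: e3_def \<kappa>_def[symmetric])
    show "e2 \<bullet> e3 = 0" "e3 \<bullet> e1 = 0" by (simp_all add: e3_def inner_commute[of e2])
  qed
qed

text \<open>Cross terms vanish because the triple annihilates the remainders \<open>w\<close> and
  \<open>u\<close>. Serves once for the whole space and once for the complement of the first
  triple.\<close>

lemma br_triple_expansion:
  assumes r: "br e1 e2 = \<kappa> *\<^sub>R e3" "br e2 e3 = \<kappa> *\<^sub>R e1" "br e3 e1 = \<kappa> *\<^sub>R e2"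
    and w: "\<And>i. i \<in> {e1, e2, e3} \<Longrightarrow> br i w = 0"
      "x = (e1 \<bullet> x) *\<^sub>R e1 + (e2 \<bullet> x) *\<^sub>R e2 + (e3 \<bullet> x) *\<^sub>R e3 + w"
    and u: "\<And>i. i \<in> {e1, e2, e3} \<Longrightarrow> br i u = 0"
      "y = (e1 \<bullet> y) *\<^sub>R e1 + (e2 \<bullet> y) *\<^sub>R e2 + (e3 \<bullet> y) *\<^sub>R e3 + u"
  shows "br x y = wedge_bracket (\<kappa> *\<^sub>R e1) e2 e3 x y + br w u"
proof -
  have r': "br e2 e1 = - (\<kappa> *\<^sub>R e3)" "br e3 e2 = - (\<kappa> *\<^sub>R e1)" "br e1 e3 = - (\<kappa> *\<^sub>R e2)"
    using r anticommute by metis+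
  have w': "br w e1 = 0" "br w e2 = 0" "br w e3 = 0"
    using w(1) anticommute by (metis insertCI neg_0_equal_iff_equal)+
  have u': "br e1 u = 0" "br e2 u = 0" "br e3 u = 0" using u(1) by auto
  define p1 p2 p3 q1 q2 q3 where "p1 = e1 \<bullet> x" "p2 = e2 \<bullet> x" "p3 = e3 \<bullet> x"
    "q1 = e1 \<bullet> y" "q2 = e2 \<bullet> y" "q3 = e3 \<bullet> y"
  note d = this
  have x: "x = p1 *\<^sub>R e1 + p2 *\<^sub>R e2 + p3 *\<^sub>R e3 + w" using w(2) by (simp only: d)
  have y: "y = q1 *\<^sub>R e1 + q2 *\<^sub>R e2 + q3 *\<^sub>R e3 + u" using u(2) by (simp only: d)
  have "br x y = (\<kappa> * (p2 * q3 - p3 * q2)) *\<^sub>R e1 + (\<kappa> * (p3 * q1 - p1 * q3)) *\<^sub>R e2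
      + (\<kappa> * (p1 * q2 - p2 * q1)) *\<^sub>R e3 + br w u"
    by (subst x, subst y) (simp add: br_simps r r' w' u' algebra_simps)
  also have "\<dots> = wedge_bracket (\<kappa> *\<^sub>R e1) e2 e3 x y + br w u"
    by (simp add: wedge_bracket_def d[symmetric] algebra_simps)
  finally show ?thesis .
qed

end

section \<open>The action of a maximal su(2) on its orthogonal complement\<close>

locale unit_triple = metric_lie_algebra +
  fixes e1 e2 e3
  assumes norms: "norm e1 = 1" "norm e2 = 1" "norm e3 = 1"
    and orth: "e1 \<bullet> e2 = 0" "e2 \<bullet> e3 = 0" "e3 \<bullet> e1 = 0"
    and triple: "br e1 e2 = e3" "br e2 e3 = e1" "br e3 e1 = e2"
    and bound: "norm (br x y) \<le> norm x * norm y"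
begin

lemma triple_rev: "br e2 e1 = - e3" "br e3 e2 = - e1" "br e1 e3 = - e2"
  using triple anticommute by metis+

definition W where "W = {w. e1 \<bullet> w = 0 \<and> e2 \<bullet> w = 0 \<and> e3 \<bullet> w = 0}"

lemma subspace_W: "subspace W"
  by (auto simp: subspace_def W_def inner_add_right)

lemma br_W: assumes "w \<in> W" shows "br e1 w \<in> W" "br e2 w \<in> W" "br e3 w \<in> W"
  using assms br_skew[of e1 w] br_skew[of e2 w] br_skew[of e3 w]
  by (auto simp: W_def inner_commute[of _ "br _ w"] triple triple_rev inner_minus_right
      inner_commute[of w])

text \<open>The operators \<open>br e1\<close>, \<open>br e2\<close>, \<open>br e3\<close> represent
  su(2); the weight computations below rest on these commutators.\<close>

lemma comm12: "br e1 (br e2 w) = br e2 (br e1 w) + br e3 w"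
  and comm23: "br e2 (br e3 w) = br e3 (br e2 w) + br e1 w"
  and comm31: "br e3 (br e1 w) = br e1 (br e3 w) + br e2 w"
  using jacobi[of e1 e2 w] jacobi[of e2 e3 w] jacobi[of e3 e1 w] triple by simp_all

text \<open>Excludes weight 1 outside the triple. Such a vector behaves like a second root vector
  beside \<open>e2\<close>, and polarising the eigenvector equation over their sum makes
  \<open>br e1\<close> rotate \<open>br e2 v\<close> and \<open>br e3 v\<close> into each other at
  speed 2. The bound allows only speed 1.\<close>

lemma no_second_root_vector:
  assumes "v \<in> W" "br e1 (br e1 v) = - v"
  shows "v = 0"
proof -
  \<comment> \<open>Here \<open>br e1\<close> preserves the norm of \<open>Y\<close>, so
    \<open>br Y\<close> attains the bound \<open>norm Y\<close> at \<open>e1\<close>.\<close>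
  have max: "br Y (br Y e1) = - ((norm Y)\<^sup>2 *\<^sub>R e1)" if "br e1 (br e1 Y) = - Y" for Y
  proof (rule skew_maximizer_eigenvector[OF br_skew])
    show "norm (br Y (br Y e1)) \<le> norm Y * norm (br Y e1)" by (rule bound)
    have "norm Y = norm (br e1 (br e1 Y))" using that by simp
    also have "\<dots> \<le> norm (br e1 Y)" using bound[of e1 "br e1 Y"] norms by simp
    finally show "norm (br Y e1) = norm Y * norm e1"
      using bound[of e1 Y] norms anticommute[of Y e1] by simp
  qed
  have key: "br e3 Y = br e2 (br e1 Y)" if Y: "Y \<in> W" "br e1 (br e1 Y) = - Y" for Y
  proof -
    have 2: "br e1 (br e1 e2) = - e2" by (simp add: triple triple_rev)
    \<comment> \<open>\<open>e2 + Y\<close> satisfies the same equation as its two summands, and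
      since \<open>Y\<close> is orthogonal to \<open>e2\<close> the squared norms add. Hence the
      mixed terms of the quadratic expression in \<open>max\<close> cancel.\<close>
    have s: "br e1 (br e1 (e2 + Y)) = - (e2 + Y)" using 2 Y(2) by (simp add: br_simps)
    have n: "(norm (e2 + Y))\<^sup>2 = (norm e2)\<^sup>2 + (norm Y)\<^sup>2"
      using Y(1) by (simp add: power2_norm_eq_inner inner_add_left inner_add_right W_def inner_commute)
    have "br (e2 + Y) (br (e2 + Y) e1) = br e2 (br e2 e1) + br Y (br Y e1)"
      unfolding max[OF 2] max[OF Y(2)] max[OF s] n by (simp add: scaleR_add_left)
    then have "br e2 (br Y e1) + br Y (br e2 e1) = 0"
      by (simp add: br_simps add.commute)
    then show ?thesis
      using anticommute[of Y e1] anticommute[of Y e3] by (simp add: br_simps triple_rev)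
  qed
  have 1: "br e3 v = br e2 (br e1 v)" by (rule key[OF assms])
  have 2: "br e3 (br e1 v) = - br e2 v"
    using key[OF br_W(1)[OF assms(1)]] assms(2) by (simp add: br_simps)
  have "br e1 (br e2 v) = 2 *\<^sub>R br e3 v" using comm12[of v] 1 by (simp add: scaleR_2)
  then have 3: "2 * norm (br e3 v) \<le> norm (br e2 v)" using bound[of e1 "br e2 v"] norms by simp
  have "br e1 (br e3 v) = br e3 (br e1 v) - br e2 v" using comm31[of v] by simp
  then have "br e1 (br e3 v) = - 2 *\<^sub>R br e2 v" unfolding 2 by (simp add: scaleR_2)
  then have 4: "2 * norm (br e2 v) \<le> norm (br e3 v)" using bound[of e1 "br e3 v"] norms by simp
  have "norm (br e2 v) = 0" "norm (br e3 v) = 0"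
    using 3 4 norm_ge_zero[of "br e2 v"] norm_ge_zero[of "br e3 v"] by linarith+
  then have "br e1 v = 0" using comm23[of v] by (simp add: br_simps)
  then show ?thesis using assms(2) by (simp add: br_simps)
qed

text \<open>On \<open>v\<close>, twice the operators \<open>br e1\<close>, \<open>br e2\<close>,
  \<open>br e3\<close> multiply like the quaternion units i, j, k. The largest weight \<mu> on the
  complement is below 1 by the previous exclusion, and raising and lowering then leave only
  1/2.\<close>

lemma weight_half_relations:
  assumes v: "v \<in> W" "norm v = 1"
    and \<mu>: "\<And>x. x \<in> W \<Longrightarrow> norm (br e1 x) \<le> \<mu> * norm x" "norm (br e1 v) = \<mu>" "\<mu> > 0"
  shows "br e1 (br e1 v) = - (1/4) *\<^sub>R v" "br e2 (br e2 v) = - (1/4) *\<^sub>R v"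
    "br e3 (br e3 v) = - (1/4) *\<^sub>R v"
    "br e1 (br e2 v) = (1/2) *\<^sub>R br e3 v" "br e2 (br e1 v) = - (1/2) *\<^sub>R br e3 v"
    "br e2 (br e3 v) = (1/2) *\<^sub>R br e1 v" "br e3 (br e2 v) = - (1/2) *\<^sub>R br e1 v"
    "br e3 (br e1 v) = (1/2) *\<^sub>R br e2 v" "br e1 (br e3 v) = - (1/2) *\<^sub>R br e2 v"
proof -
  let ?a = "br e1" and ?b = "br e2" and ?c = "br e3"
  have aa: "?a (?a v) = - (\<mu>\<^sup>2 *\<^sub>R v)"
    by (rule skew_maximizer_eigenvector[OF br_skew])
      (use \<mu>(1)[of "?a v"] \<mu>(2) br_W v in simp_all)
  have "v \<noteq> 0" using v by auto
  have "\<mu> \<le> 1" using bound[of e1 v] norms v(2) \<mu>(2) by simp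
  moreover have "\<mu> \<noteq> 1" using no_second_root_vector[OF v(1)] aa \<open>v \<noteq> 0\<close> by auto
  ultimately have lt: "\<mu> < 1" by simp
  \<comment> \<open>\<open>p\<close> and \<open>q\<close> are, up to sign, the real and imaginary
    parts of a vector of weight \<open>k\<close>, rotated into each other at a speed that \<mu> does
    not allow.\<close>
  have large: "p = 0 \<and> q = 0"
    if "p \<in> W" "q \<in> W" "?a p = k *\<^sub>R q" "?a q = - (k *\<^sub>R p)" "k > \<mu>" for p q k
  proof -
    have 1: "k * norm q \<le> \<mu> * norm p" "k * norm p \<le> \<mu> * norm q"
      using \<mu>(1)[OF that(1)] \<mu>(1)[OF that(2)] that(3-5) \<mu>(3) by simp_all
    have "(k - \<mu>) * (norm p + norm q) \<le> 0" using 1 by (simp add: algebra_simps)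
    then have "norm p + norm q \<le> 0" using that(5) by (simp add: mult_le_0_iff)
    then show ?thesis using norm_ge_zero[of p] norm_ge_zero[of q] by (smt (verit) norm_le_zero_iff)
  qed
  note Wi = subspace_add[OF subspace_W] subspace_diff[OF subspace_W] subspace_scale[OF subspace_W]
  txt \<open>
    In the complexification, \<open>\<mu> v - i [e1, v]\<close> has weight \<open>\<mu>\<close> under \<open>- i [e1, _]\<close>. Raising it by
    \<open>e2 - i e3\<close> gives weight \<open>\<mu> + 1\<close>; lowering it twice by \<open>e2 + i e3\<close> gives weight \<open>\<mu> - 2\<close>.
    Both exceed the largest weight in absolute value.
  \<close>
  have up: "\<mu> *\<^sub>R ?b v - ?c (?a v) = 0 \<and> \<mu> *\<^sub>R ?c v + ?b (?a v) = 0"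
  proof (rule large)
    show "\<mu> *\<^sub>R ?b v - ?c (?a v) \<in> W" "\<mu> *\<^sub>R ?c v + ?b (?a v) \<in> W"
      by (intro Wi br_W v)+
    have 1: "?a (?c (?a v)) = - (\<mu>\<^sup>2 *\<^sub>R ?c v) - ?b (?a v)"
      using comm31[of "?a v"] by (simp add: aa br_simps algebra_simps)
    have 2: "?a (?b (?a v)) = - (\<mu>\<^sup>2 *\<^sub>R ?b v) + ?c (?a v)"
      using comm12[of "?a v"] by (simp add: aa br_simps algebra_simps)
    have 3: "?a (?b v) = ?b (?a v) + ?c v" "?a (?c v) = ?c (?a v) - ?b v"
      using comm12[of v] comm31[of v] by simp_all
    show "?a (\<mu> *\<^sub>R ?b v - ?c (?a v)) = (\<mu> + 1) *\<^sub>R (\<mu> *\<^sub>R ?c v + ?b (?a v))"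
      by (simp add: br_simps 1 2 3 algebra_simps power2_eq_square)
    show "?a (\<mu> *\<^sub>R ?c v + ?b (?a v)) = - ((\<mu> + 1) *\<^sub>R (\<mu> *\<^sub>R ?b v - ?c (?a v)))"
      by (simp add: br_simps 1 2 3 algebra_simps power2_eq_square)
  qed simp
  have ca: "?c (?a v) = \<mu> *\<^sub>R ?b v" and ba: "?b (?a v) = - (\<mu> *\<^sub>R ?c v)"
    using up by (simp_all add: eq_neg_iff_add_eq_0 add.commute)
  have ab: "?a (?b v) = (1 - \<mu>) *\<^sub>R ?c v" using comm12[of v] ba by (simp add: algebra_simps)
  have ac: "?a (?c v) = - ((1 - \<mu>) *\<^sub>R ?b v)" using comm31[of v] ca by (simp add: algebra_simps)
  have down: "?b (?b v) - ?c (?c v) = 0 \<and> ?b (?c v) + ?c (?b v) = 0"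
  proof (rule large)
    show "?b (?b v) - ?c (?c v) \<in> W" "?b (?c v) + ?c (?b v) \<in> W"
      by (intro Wi br_W v)+
    show "?a (?b (?b v) - ?c (?c v)) = (2 - \<mu>) *\<^sub>R (?b (?c v) + ?c (?b v))"
      using comm12[of "?b v"] comm31[of "?c v"]
      by (simp add: br_simps ab ac algebra_simps) (simp add: scaleR_2)
    show "?a (?b (?c v) + ?c (?b v)) = - ((2 - \<mu>) *\<^sub>R (?b (?b v) - ?c (?c v)))"
      using comm12[of "?c v"] comm31[of "?b v"] by (simp add: br_simps ab ac algebra_simps scaleR_2)
    show "2 - \<mu> > \<mu>" using lt by simp
  qed
  have cc: "?c (?c v) = ?b (?b v)" using down by simp
  have "?c (?b v) = - ?b (?c v)" using down by (simp add: eq_neg_iff_add_eq_0 add.commute)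
  then have "2 *\<^sub>R ?b (?c v) = ?a v" using comm23[of v] by (simp add: scaleR_2 algebra_simps)
  then have bc: "?b (?c v) = (1/2) *\<^sub>R ?a v"
    by (metis divideR_right scaleR_half_double scaleR_2 inverse_eq_divide zero_neq_numeral)
  then have cb: "?c (?b v) = - (1/2) *\<^sub>R ?a v" using \<open>?c (?b v) = - ?b (?c v)\<close> by simp
  \<comment> \<open>The commutator of \<open>e2\<close> and \<open>e3\<close> at two further vectors
    fixes the weight: at \<open>br e1 v\<close> it shows that the square of \<open>br e2\<close> is
    -\<mu>/2 on \<open>v\<close>, and at \<open>br e2 v\<close> it equates \<mu>/2 with 1 -
    3\<mu>/2.\<close>
  have "?b (?c (?a v)) = ?c (?b (?a v)) + ?a (?a v)" by (rule comm23)
  then have "(2 * \<mu>) *\<^sub>R ?b (?b v) = (2 * \<mu>) *\<^sub>R (- (\<mu>/2) *\<^sub>R v)"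
    unfolding aa ca ba by (simp add: br_simps cc algebra_simps power2_eq_square scaleR_2[symmetric])
  then have bb: "?b (?b v) = - (\<mu>/2) *\<^sub>R v" using \<mu>(3) by (simp only: scaleR_cancel_left) simp
  have "?b (?c (?b v)) = ?c (?b (?b v)) + ?a (?b v)" by (rule comm23)
  then have "(\<mu>/2) *\<^sub>R ?c v = (- (\<mu>/2) + (1 - \<mu>)) *\<^sub>R ?c v"
    unfolding cb bb ab by (simp add: br_simps ba scaleR_add_left[symmetric] scaleR_diff_left[symmetric])
  moreover have "?c v \<noteq> 0"
    using cc bb \<open>v \<noteq> 0\<close> \<mu>(3) by (auto simp: br_simps)
  ultimately have half: "\<mu> = 1/2" by (simp only: scaleR_cancel_right) simp
  show "?a (?a v) = - (1/4) *\<^sub>R v" "?b (?b v) = - (1/4) *\<^sub>R v" "?c (?c v) = - (1/4) *\<^sub>R v"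
    "?a (?b v) = (1/2) *\<^sub>R ?c v" "?b (?a v) = - (1/2) *\<^sub>R ?c v"
    "?b (?c v) = (1/2) *\<^sub>R ?a v" "?c (?b v) = - (1/2) *\<^sub>R ?a v"
    "?c (?a v) = (1/2) *\<^sub>R ?b v" "?a (?c v) = - (1/2) *\<^sub>R ?b v"
    using aa bb cc ab ba bc cb ca ac by (simp_all add: half power2_eq_square)
qed

text \<open>The triple, \<open>v\<close> and its images \<open>u1\<close>, \<open>u2\<close>,
  \<open>u3\<close> fill dimension 7, so brackets among the latter four are determined by inner
  products, and the Jacobi identity for \<open>v\<close>, \<open>u1\<close>, \<open>u2\<close>
  fails. In dimension 8 the Lie algebra su(3) does contain such a \<open>v\<close>.\<close>

lemma no_weight_half:
  assumes dim: "DIM('a) = 7" and v: "v \<in> W" "norm v = 1"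
    and aa: "br e1 (br e1 v) = - (1/4) *\<^sub>R v" and bb: "br e2 (br e2 v) = - (1/4) *\<^sub>R v"
    and cc: "br e3 (br e3 v) = - (1/4) *\<^sub>R v"
    and ab: "br e1 (br e2 v) = (1/2) *\<^sub>R br e3 v" and ba: "br e2 (br e1 v) = - (1/2) *\<^sub>R br e3 v"
    and bc: "br e2 (br e3 v) = (1/2) *\<^sub>R br e1 v" and cb: "br e3 (br e2 v) = - (1/2) *\<^sub>R br e1 v"
    and ca: "br e3 (br e1 v) = (1/2) *\<^sub>R br e2 v" and ac: "br e1 (br e3 v) = - (1/2) *\<^sub>R br e2 v"
  shows False
proof -
  define u1 u2 u3 where "u1 = br e1 v" and "u2 = br e2 v" and "u3 = br e3 v"
  note u = u1_def[symmetric] u2_def[symmetric] u3_def[symmetric]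
  note rel = aa[unfolded u] bb[unfolded u] cc[unfolded u] ab[unfolded u] ba[unfolded u]
    bc[unfolded u] cb[unfolded u] ca[unfolded u] ac[unfolded u]
  have W: "u1 \<in> W" "u2 \<in> W" "u3 \<in> W" unfolding u1_def u2_def u3_def using br_W v by blast+
  have vv: "v \<bullet> v = 1" using v(2) by (simp add: norm_eq_1)
  have ov: "v \<bullet> u1 = 0" "v \<bullet> u2 = 0" "v \<bullet> u3 = 0"
    by (simp_all add: u1_def u2_def u3_def inner_commute[of v])
  have nu: "u1 \<bullet> u1 = 1/4" "u2 \<bullet> u2 = 1/4" "u3 \<bullet> u3 = 1/4"
    using br_skew[of e1 v u1] br_skew[of e2 v u2] br_skew[of e3 v u3]
    by (simp_all add: u rel vv)
  have ou: "u1 \<bullet> u2 = 0" "u2 \<bullet> u3 = 0" "u1 \<bullet> u3 = 0"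
    using br_skew[of e1 v u2] br_skew[of e2 v u3] br_skew[of e1 v u3]
    by (simp_all add: u rel ov)
  note sym = inner_commute[of u1 v] inner_commute[of u2 v] inner_commute[of u3 v]
    inner_commute[of u2 u1] inner_commute[of u3 u2] inner_commute[of u3 u1]
  \<comment> \<open>An eighth orthogonal direction does not exist, so a vector equation may be
    checked by pairing with these seven.\<close>
  have complete: "z = 0" if "e1 \<bullet> z = 0" "e2 \<bullet> z = 0" "e3 \<bullet> z = 0" "v \<bullet> z = 0"
    "u1 \<bullet> z = 0" "u2 \<bullet> z = 0" "u3 \<bullet> z = 0" for z
  proof (rule ccontr)
    assume "z \<noteq> 0"
    have nz: "e1 \<noteq> 0" "e2 \<noteq> 0" "e3 \<noteq> 0" "v \<noteq> 0" "u1 \<noteq> 0" "u2 \<noteq> 0" "u3 \<noteq> 0"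
      using norms v nu by auto
    have "length [e1, e2, e3, v, u1, u2, u3, z] \<le> DIM('a)"
      by (rule length_orthogonal_le_DIM)
        (use that \<open>z \<noteq> 0\<close> nz v W orth ov ou in
          \<open>auto simp: orthogonal_def W_def inner_commute[of e1 e3]\<close>)
    then show False using dim by simp
  qed
  \<comment> \<open>In each instance two of the three terms vanish because a vector occurs twice,
    which leaves one component of the trilinear form on \<open>v\<close>, \<open>u1\<close>,
    \<open>u2\<close>, \<open>u3\<close>.\<close>
  have z1: "br v u1 \<bullet> u2 = 0"
    using br_inner_derivation[of e2 v u3 u2] by (simp add: u rel br_simps)
  have z2: "br v u1 \<bullet> u3 = 0"
    using br_inner_derivation[of e3 v u2 u3] by (simp add: u rel br_simps)
  have z3: "br v u2 \<bullet> u3 = 0"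
    using br_inner_derivation[of e3 v u1 u3] by (simp add: u rel br_simps)
  have z4: "br u1 u2 \<bullet> u3 = 0"
    using br_inner_derivation[of e3 v u1 u2] br_inner_cycle[of u3 u1 u2] by (simp add: u rel br_simps)
  \<comment> \<open>The coefficient is \<open>br e1 v \<bullet> u1 = u1 \<bullet> u1 = 1/4\<close>
    by invariance; below, 1/8 arises as
    \<open>br e3 u1 \<bullet> u2 = (1/2) * (u2 \<bullet> u2)\<close>.\<close>
  have 1: "br v u1 - (1/4) *\<^sub>R e1 = 0"
  proof (rule complete)
    show "e1 \<bullet> (br v u1 - (1/4) *\<^sub>R e1) = 0" "e2 \<bullet> (br v u1 - (1/4) *\<^sub>R e1) = 0"
      "e3 \<bullet> (br v u1 - (1/4) *\<^sub>R e1) = 0"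
      using invariant[of e1 v u1] invariant[of e2 v u1] invariant[of e3 v u1] norms orth
      by (simp_all add: inner_diff_right u nu ou sym norm_eq_1 inner_commute[of e2 e1])
  next
    show "v \<bullet> (br v u1 - (1/4) *\<^sub>R e1) = 0" "u1 \<bullet> (br v u1 - (1/4) *\<^sub>R e1) = 0"
      "u2 \<bullet> (br v u1 - (1/4) *\<^sub>R e1) = 0" "u3 \<bullet> (br v u1 - (1/4) *\<^sub>R e1) = 0"
      using v W z1 z2 by (simp_all add: inner_diff_right W_def inner_commute[of _ "br v u1"] inner_commute[of _ e1])
  qed
  have 2: "br v u2 - (1/4) *\<^sub>R e2 = 0"
  proof (rule complete)
    show "e1 \<bullet> (br v u2 - (1/4) *\<^sub>R e2) = 0" "e2 \<bullet> (br v u2 - (1/4) *\<^sub>R e2) = 0"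
      "e3 \<bullet> (br v u2 - (1/4) *\<^sub>R e2) = 0"
      using invariant[of e1 v u2] invariant[of e2 v u2] invariant[of e3 v u2] norms orth
      by (simp_all add: inner_diff_right u nu ou sym norm_eq_1 inner_commute[of e3 e2])
  next
    have "br v u2 \<bullet> u1 = 0"
      using z1 br_inner_cycle[of v u2 u1] br_inner_cycle[of u1 v u2] anticommute[of u2 u1]
        br_inner_cycle[of v u1 u2] by (simp add: inner_minus_left)
    then show "v \<bullet> (br v u2 - (1/4) *\<^sub>R e2) = 0" "u1 \<bullet> (br v u2 - (1/4) *\<^sub>R e2) = 0"
      "u2 \<bullet> (br v u2 - (1/4) *\<^sub>R e2) = 0" "u3 \<bullet> (br v u2 - (1/4) *\<^sub>R e2) = 0"
      using v W z3 by (simp_all add: inner_diff_right W_def inner_commute[of _ "br v u2"] inner_commute[of _ e2])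
  qed
  have 3: "br u1 u2 - (1/8) *\<^sub>R e3 = 0"
  proof (rule complete)
    show "e1 \<bullet> (br u1 u2 - (1/8) *\<^sub>R e3) = 0" "e2 \<bullet> (br u1 u2 - (1/8) *\<^sub>R e3) = 0"
      "e3 \<bullet> (br u1 u2 - (1/8) *\<^sub>R e3) = 0"
      using invariant[of e1 u1 u2] invariant[of e2 u1 u2] invariant[of e3 u1 u2] norms orth
      by (simp_all add: inner_diff_right u rel nu ou ov sym norm_eq_1 inner_commute[of e1 e3])
  next
    have "br u1 u2 \<bullet> v = 0"
      using z1 br_inner_cycle[of v u1 u2] by simp
    then show "v \<bullet> (br u1 u2 - (1/8) *\<^sub>R e3) = 0" "u1 \<bullet> (br u1 u2 - (1/8) *\<^sub>R e3) = 0"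
      "u2 \<bullet> (br u1 u2 - (1/8) *\<^sub>R e3) = 0" "u3 \<bullet> (br u1 u2 - (1/8) *\<^sub>R e3) = 0"
      using v W z4 by (simp_all add: inner_diff_right W_def inner_commute[of _ "br u1 u2"] inner_commute[of _ e3])
  qed
  have b1: "br v u1 = (1/4) *\<^sub>R e1" and b2: "br v u2 = (1/4) *\<^sub>R e2" and b3: "br u1 u2 = (1/8) *\<^sub>R e3"
    using 1 2 3 by simp_all
  \<comment> \<open>The left side is -1/8 times \<open>u3\<close>, the right side 1/4 times
    \<open>u3\<close>.\<close>
  have "br v (br u1 u2) = br (br v u1) u2 + br u1 (br v u2)" by (rule jacobi)
  then have "- (1/8) *\<^sub>R u3 = (1/8) *\<^sub>R u3 + (1/8) *\<^sub>R u3"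
    unfolding b1 b2 b3
    using anticommute[of v e3] anticommute[of u1 e2] by (simp add: br_simps u rel)
  then have "(- (1/8)) *\<^sub>R u3 = (1/4) *\<^sub>R u3" by (simp add: scaleR_add_left[symmetric])
  then have "u3 = 0" by (simp only: scaleR_cancel_right) simp
  then show False using nu by simp
qed

text \<open>A nonzero action of \<open>br e1\<close> on \<open>W\<close> would attain its maximum on
  the unit sphere at a vector of the kind just excluded. As \<open>e2\<close> and \<open>e3\<close>
  are commutators involving \<open>e1\<close> and \<open>W\<close> is invariant, they act by zero
  too.\<close>

lemma triple_centralizes_complement:
  assumes dim: "DIM('a) = 7" and w: "w \<in> W"
  shows "br e1 w = 0" "br e2 w = 0" "br e3 w = 0"
proof -
  have a0: "br e1 w = 0" if w: "w \<in> W" for w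
  proof (rule ccontr)
    assume nz: "br e1 w \<noteq> 0"
    let ?S = "W \<inter> sphere 0 1"
    have unit: "inverse (norm x) *\<^sub>R x \<in> ?S" if "x \<in> W" "x \<noteq> 0" for x
      using that subspace_W by (simp add: subspace_scale)
    have "w \<noteq> 0" using nz by (auto simp: br_simps)
    have cpt: "compact ?S"
      using closed_subspace[OF subspace_W] by (intro closed_Int_compact) auto
    have ne: "?S \<noteq> {}" using unit[OF w \<open>w \<noteq> 0\<close>] by blast
    have lin: "linear (br e1)" using bilinear by (simp add: bilinear_def)
    have cont: "continuous_on ?S (\<lambda>x. norm (br e1 x))"
      by (intro continuous_intros linear_continuous_on linear_linear[THEN iffD2] lin)
    obtain v where v: "v \<in> ?S" and vm: "\<And>x. x \<in> ?S \<Longrightarrow> norm (br e1 x) \<le> norm (br e1 v)"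
      using continuous_attains_sup[OF cpt ne cont] by blast
    define \<mu> where "\<mu> = norm (br e1 v)"
    have \<mu>: "norm (br e1 x) \<le> \<mu> * norm x" if "x \<in> W" for x
    proof (cases "x = 0")
      case False
      then show ?thesis using vm[OF unit[OF that False]]
        by (simp add: br_simps \<mu>_def field_simps)
    qed (simp add: br_simps)
    have pos: "\<mu> > 0"
    proof (rule ccontr)
      assume "\<not> \<mu> > 0"
      then have "\<mu> = 0" by (simp add: \<mu>_def)
      then show False using \<mu>[OF w] nz by simp
    qed
    have v': "v \<in> W" "norm v = 1" using v by auto
    show False
      by (rule no_weight_half[OF dim v' weight_half_relations[OF v' \<mu> \<mu>_def[symmetric] pos]])
  qed
  show "br e1 w = 0" by (rule a0[OF w])
  show b: "br e2 w = 0"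
    using comm31[of w] a0[OF w] a0[OF br_W(3)[OF w]] by (simp add: br_simps)
  show "br e3 w = 0"
    using comm12[of w] a0[OF w] a0[OF br_W(2)[OF w]] b by (simp add: br_simps)
qed

end

section \<open>Decomposition into orthogonal ideals in dimension 7\<close>

context metric_lie_algebra
begin

theorem seven_dimensional_decomposition:
  assumes dim: "DIM('a) = 7"
  obtains a1 a2 a3 b1 b2 b3 where
    "\<And>a b. a \<in> {a1, a2, a3} \<Longrightarrow> b \<in> {b1, b2, b3} \<Longrightarrow> a \<bullet> b = 0"
    "\<And>x y. br x y = wedge_bracket a1 a2 a3 x y + wedge_bracket b1 b2 b3 x y"
proof (cases "\<forall>x y. br x y = 0")
  case True
  show ?thesis by (rule that[of 0 0 0 0 0 0]) (simp_all add: True wedge_bracket_def)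
next
  case False
  then obtain x0 y0 where xy0: "br x0 y0 \<noteq> 0" by blast
  obtain \<kappa> e1 e2 e3 where pos: "\<kappa> > 0"
    and ne: "norm e1 = 1" "norm e2 = 1" "norm e3 = 1"
    and oe: "e1 \<bullet> e2 = 0" "e2 \<bullet> e3 = 0" "e3 \<bullet> e1 = 0"
    and re: "br e1 e2 = \<kappa> *\<^sub>R e3" "br e2 e3 = \<kappa> *\<^sub>R e1" "br e3 e1 = \<kappa> *\<^sub>R e2"
    and be: "\<And>x y. norm (br x y) \<le> \<kappa> * norm x * norm y"
    using maximal_triple[OF subspace_UNIV UNIV_I UNIV_I UNIV_I xy0] UNIV_I by metis
  interpret scaled: metric_lie_algebra "\<lambda>x y. inverse \<kappa> *\<^sub>R br x y" by (rule scale)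
  interpret scaled: unit_triple "\<lambda>x y. inverse \<kappa> *\<^sub>R br x y" e1 e2 e3
    by unfold_locales (use pos ne oe re be in \<open>simp_all add: field_simps\<close>)
  define W where "W = {w. e1 \<bullet> w = 0 \<and> e2 \<bullet> w = 0 \<and> e3 \<bullet> w = 0}"
  have W: "subspace W" using scaled.subspace_W by (simp add: W_def scaled.W_def)
  have e0: "br i w = 0" if "w \<in> W" "i \<in> {e1, e2, e3}" for i w
    using scaled.triple_centralizes_complement[OF dim] that pos
    by (auto simp: W_def scaled.W_def)
  \<comment> \<open>Invariance moves the bracket onto \<open>e1\<close>, \<open>e2\<close>,
    \<open>e3\<close>, which annihilate \<open>W\<close>. So the complement is a subalgebra, and a
    maximal pair can be chosen again inside it.\<close>
  have closed: "br x y \<in> W" if "x \<in> W" "y \<in> W" for x y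
    using invariant[of e1 x y] invariant[of e2 x y] invariant[of e3 x y] e0[OF that(1)]
    by (simp add: W_def)
  define P where "P x = x - ((e1 \<bullet> x) *\<^sub>R e1 + (e2 \<bullet> x) *\<^sub>R e2 + (e3 \<bullet> x) *\<^sub>R e3)" for x
  have P: "P x \<in> W" for x
    using ne oe by (simp add: P_def W_def inner_diff_right inner_add_right norm_eq_1
      inner_commute[of e2 e1] inner_commute[of e3 e2] inner_commute[of e1 e3])
  have expand: "br x y = wedge_bracket (\<kappa> *\<^sub>R e1) e2 e3 x y + br (P x) (P y)" for x y
    by (rule br_triple_expansion[OF re]) (use e0[OF P] in \<open>auto simp: P_def\<close>)
  show ?thesis
  proof (cases "\<forall>x\<in>W. \<forall>y\<in>W. br x y = 0")
    case True
    have "br x y = wedge_bracket 0 0 0 x y + wedge_bracket (\<kappa> *\<^sub>R e1) e2 e3 x y" for x y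
      using expand[of x y] True P by (simp add: wedge_bracket_def)
    then show ?thesis
      by (rule that[rotated]) auto
  next
    case False
    then obtain x1 y1 where xy1: "x1 \<in> W" "y1 \<in> W" "br x1 y1 \<noteq> 0" by blast
    obtain \<nu> f1 f2 f3 where pos': "\<nu> > 0"
      and fW: "f1 \<in> W" "f2 \<in> W" "f3 \<in> W"
      and nf: "norm f1 = 1" "norm f2 = 1" "norm f3 = 1"
      and of: "f1 \<bullet> f2 = 0" "f2 \<bullet> f3 = 0" "f3 \<bullet> f1 = 0"
      and rf: "br f1 f2 = \<nu> *\<^sub>R f3" "br f2 f3 = \<nu> *\<^sub>R f1" "br f3 f1 = \<nu> *\<^sub>R f2"
      using maximal_triple[OF W closed xy1] by metis
    define L where "L = {w \<in> W. f1 \<bullet> w = 0 \<and> f2 \<bullet> w = 0 \<and> f3 \<bullet> w = 0}"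
    have LW: "w \<in> W" if "w \<in> L" for w using that by (simp add: L_def)
    \<comment> \<open>Six dimensions are taken by the two triples, so \<open>L\<close> is at most a
      line.\<close>
    have line: "z = 0" if w: "w \<in> L" "w \<noteq> 0" and z: "z \<in> L" "w \<bullet> z = 0" for w z
    proof (rule ccontr)
      assume "z \<noteq> 0"
      have "length [e1, e2, e3, f1, f2, f3, w, z] \<le> DIM('a)"
        by (rule length_orthogonal_le_DIM)
          (use w z \<open>z \<noteq> 0\<close> ne nf oe of fW in
            \<open>auto simp: orthogonal_def L_def W_def inner_commute[of e1 e3] inner_commute[of f1 f3]\<close>)
      then show False using dim by simp
    qed
    \<comment> \<open>\<open>br i w\<close> stays in \<open>L\<close>, by invariance and because the
      span of \<open>f1\<close>, \<open>f2\<close>, \<open>f3\<close> is closed under the bracket.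
      It is also orthogonal to \<open>w\<close>, which on a line leaves only 0.\<close>
    have f0: "br i w = 0" if w: "w \<in> L" and i: "i \<in> {f1, f2, f3}" for i w
    proof (cases "w = 0")
      case False
      have "f \<bullet> br i w = 0" if "f \<in> {f1, f2, f3}" for f
      proof -
        have "br f i \<in> {0, \<nu> *\<^sub>R f1, \<nu> *\<^sub>R f2, \<nu> *\<^sub>R f3, - (\<nu> *\<^sub>R f1), - (\<nu> *\<^sub>R f2), - (\<nu> *\<^sub>R f3)}"
          using that i rf anticommute[of f2 f1] anticommute[of f3 f2] anticommute[of f1 f3] by auto
        then show ?thesis using w invariant[of f i w] by (auto simp: L_def)
      qed
      moreover have "br i w \<in> W" using closed[OF _ LW[OF w]] i fW by blast
      ultimately have "br i w \<in> L" by (simp add: L_def)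
      then show ?thesis using line[OF w False] by (simp add: inner_commute[of w])
    qed (simp add: br_simps)
    have L0: "br w u = 0" if w: "w \<in> L" and u: "u \<in> L" for w u
    proof (cases "w = 0")
      case False
      define c where "c = (w \<bullet> u) / (w \<bullet> w)"
      have "u - c *\<^sub>R w \<in> L" using w u W
        by (simp add: L_def subspace_diff subspace_scale inner_diff_right)
      moreover have "w \<bullet> (u - c *\<^sub>R w) = 0" using False by (simp add: c_def inner_diff_right)
      ultimately have "u - c *\<^sub>R w = 0" by (rule line[OF w False])
      then have "u = c *\<^sub>R w" by simp
      then show ?thesis by (simp add: br_simps)
    qed (simp add: br_simps)
    define Q where "Q x = x - ((f1 \<bullet> x) *\<^sub>R f1 + (f2 \<bullet> x) *\<^sub>R f2 + (f3 \<bullet> x) *\<^sub>R f3)" for x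
    have Q: "Q x \<in> L" if "x \<in> W" for x
    proof -
      have "Q x \<in> W" unfolding Q_def
        by (intro subspace_diff[OF W] subspace_add[OF W] subspace_scale[OF W] that fW)
      then show ?thesis
        using nf of by (simp add: Q_def L_def inner_diff_right inner_add_right norm_eq_1
          inner_commute[of f2 f1] inner_commute[of f3 f2] inner_commute[of f1 f3])
    qed
    have fP: "f \<bullet> P x = f \<bullet> x" if "f \<in> W" for f x
      using that by (simp add: P_def W_def inner_diff_right inner_add_right inner_commute[of f])
    have rest: "br (P x) (P y) = wedge_bracket (\<nu> *\<^sub>R f1) f2 f3 x y" for x y
    proof -
      have "br (P x) (P y) = wedge_bracket (\<nu> *\<^sub>R f1) f2 f3 (P x) (P y) + br (Q (P x)) (Q (P y))"
        by (rule br_triple_expansion[OF rf]) (use f0[OF Q[OF P]] in \<open>auto simp: Q_def\<close>)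
      then show ?thesis
        using L0[OF Q[OF P] Q[OF P]] fW by (simp add: wedge_bracket_def fP)
    qed
    have "br x y = wedge_bracket (\<kappa> *\<^sub>R e1) e2 e3 x y + wedge_bracket (\<nu> *\<^sub>R f1) f2 f3 x y" for x y
      using expand[of x y] by (simp only: rest)
    then show ?thesis
      by (rule that[rotated]) (use fW in \<open>auto simp: W_def\<close>)
  qed
qed

end

section \<open>The bracket of a 3-form\<close>

definition three_form_bracket :: "'a::euclidean_space form \<Rightarrow> 'a \<Rightarrow> 'a \<Rightarrow> 'a"
  where "three_form_bracket F x y = sharp (\<lambda>z. F [x, y, z])"

lemma three_form_linear:
  assumes "F \<in> forms p"
  shows "linear (\<lambda>x. F [x, y, z])" "linear (\<lambda>y. F [x, y, z])" "linear (\<lambda>z. F [x, y, z])"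
  using forms_linear[OF assms, of "[]" "[y, z]"] forms_linear[OF assms, of "[x]" "[z]"]
    forms_linear[OF assms, of "[x, y]" "[]"] by simp_all

lemma three_form_bracket_inner:
  assumes "F \<in> forms p"
  shows "three_form_bracket F x y \<bullet> z = F [x, y, z]"
  unfolding three_form_bracket_def by (rule sharp_inner[OF three_form_linear(3)[OF assms]])

lemma bilinear_three_form_bracket:
  assumes "F \<in> forms p"
  shows "bilinear (three_form_bracket F)"
  unfolding bilinear_def
proof (intro conjI allI linearI)
  note inner = three_form_bracket_inner[OF assms]
  fix x y z r
  show "three_form_bracket F x (y + z) = three_form_bracket F x y + three_form_bracket F x z"
    by (rule vector_eq_rdot[THEN iffD1])
      (simp add: inner inner_add_left linear_add[OF three_form_linear(2)[OF assms]])
  show "three_form_bracket F x (r *\<^sub>R y) = r *\<^sub>R three_form_bracket F x y"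
    by (rule vector_eq_rdot[THEN iffD1])
      (simp add: inner linear_scale[OF three_form_linear(2)[OF assms]])
  show "three_form_bracket F (x + y) z = three_form_bracket F x z + three_form_bracket F y z"
    by (rule vector_eq_rdot[THEN iffD1])
      (simp add: inner inner_add_left linear_add[OF three_form_linear(1)[OF assms]])
  show "three_form_bracket F (r *\<^sub>R x) y = r *\<^sub>R three_form_bracket F x y"
    by (rule vector_eq_rdot[THEN iffD1])
      (simp add: inner linear_scale[OF three_form_linear(1)[OF assms]])
qed

lemma three_form_swap:
  assumes "F \<in> forms p"
  shows "F [x, y, z] = - F [y, x, z]" "F [x, z, y] = - F [x, y, z]"
  using forms_swap[OF assms, of "[]" x y "[z]"] forms_swap[OF assms, of "[x]" z y "[]"] by simp_all

lemma three_form_cycle: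
  assumes "F \<in> forms p"
  shows "F [x, y, z] = F [y, z, x]"
  by (simp only: three_form_swap(1)[OF assms, of x y z] three_form_swap(2)[OF assms, of y x z] minus_minus)

lemma wedge_3: "wedge \<alpha> \<Omega> [x, y, z] = \<alpha> x * \<Omega> [y, z] - \<alpha> y * \<Omega> [x, z] + \<alpha> z * \<Omega> [x, y]"
  by (simp add: wedge_Cons contract_wedge contract_def wedge_diff wedge_scale)

lemma wedge_contract_zero:
  assumes "F \<in> forms 3" "length vs \<noteq> 3" "linear \<alpha>"
  shows "wedge \<alpha> (contract c F) vs = 0"
  using wedge_forms[OF assms(3) contract_forms[OF assms(1), of c]] assms(2)
  by (intro forms_length) auto

text \<open>The action sums products of two values of \<open>F\<close> over a common basis index,
  which Parseval turns into inner products of brackets. The three terms correspond to the slot taken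
  by the one-form of the wedge.\<close>

lemma bracket_contract_three_form:
  assumes F: "F \<in> forms 3"
  defines "br \<equiv> three_form_bracket F"
  shows "bracket (contract X F) F [x, y, z] =
    br X x \<bullet> br y z - br X y \<bullet> br x z + br X z \<bullet> br x y"
proof -
  define T where "T b c = wedge (inner b) (contract c F) [x, y, z]" for b c
  have T: "T b c = (b \<bullet> x) * F [c, y, z] - (b \<bullet> y) * F [c, x, z] + (b \<bullet> z) * F [c, x, y]" for b c
    by (simp add: T_def wedge_3 contract_def)
  \<comment> \<open>Both halves of \<open>bracket_decomp\<close> contribute equally, because
    \<open>F [X, b, c]\<close> is antisymmetric in \<open>b\<close> and \<open>c\<close>; this
    cancels the factor 1/2.\<close>
  have swap: "(\<Sum>b\<in>Basis. \<Sum>c\<in>Basis. F [X, b, c] * T c b) = - (\<Sum>b\<in>Basis. \<Sum>c\<in>Basis. F [X, b, c] * T b c)"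
  proof -
    have "F [X, c, b] * T b c = - (F [X, b, c] * T b c)" for b c
      using three_form_swap(2)[OF F, of X b c] by simp
    then show ?thesis by (subst sum.swap) (simp only: sum_negf)
  qed
  have contr: "(\<Sum>b\<in>Basis. \<Sum>c\<in>Basis. F [X, b, c] * ((b \<bullet> u) * F [c, v, w])) = br X u \<bullet> br v w" for u v w
  proof -
    have "(\<Sum>b\<in>Basis. \<Sum>c\<in>Basis. F [X, b, c] * ((b \<bullet> u) * F [c, v, w]))
        = (\<Sum>c\<in>Basis. (\<Sum>b\<in>Basis. (b \<bullet> u) * F [X, b, c]) * F [c, v, w])"
      by (subst sum.swap) (simp add: sum_distrib_left sum_distrib_right mult_ac)
    also have "\<dots> = (\<Sum>c\<in>Basis. F [X, u, c] * F [c, v, w])"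
      by (simp only: linear_Basis_expansion[OF three_form_linear(2)[OF F], symmetric])
    also have "\<dots> = (\<Sum>c\<in>Basis. (br X u \<bullet> c) * (br v w \<bullet> c))"
      by (simp add: br_def three_form_bracket_inner[OF F] three_form_cycle[OF F, of _ v w])
    also have "\<dots> = br X u \<bullet> br v w" by (rule euclidean_inner[symmetric])
    finally show ?thesis .
  qed
  have "bracket (contract X F) F [x, y, z]
      = (1/2) * (\<Sum>b\<in>Basis. \<Sum>c\<in>Basis. F [X, b, c] * (T b c - T c b))"
    by (simp add: bracket_def bracket_decomp_def T_def contract_def[of X])
  also have "\<dots> = (\<Sum>b\<in>Basis. \<Sum>c\<in>Basis. F [X, b, c] * T b c)"
    using swap by (simp add: right_diff_distrib sum_subtractf)
  also have "\<dots> = br X x \<bullet> br y z - br X y \<bullet> br x z + br X z \<bullet> br x y"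
    unfolding T by (simp add: distrib_left right_diff_distrib sum.distrib sum_subtractf contr)
  finally show ?thesis .
qed

lemma bracket_contract_zero_iff:
  assumes F: "F \<in> forms 3"
  defines "br \<equiv> three_form_bracket F"
  shows "bracket (contract X F) F = zero_form \<longleftrightarrow>
    (\<forall>x y z. br X x \<bullet> br y z - br X y \<bullet> br x z + br X z \<bullet> br x y = 0)"
proof -
  have "bracket (contract X F) F = zero_form" if 0: "\<And>x y z. bracket (contract X F) F [x, y, z] = 0"
  proof
    fix vs
    show "bracket (contract X F) F vs = 0"
    proof (cases "length vs = 3")
      case True
      then obtain x y z where "vs = [x, y, z]"
        by (auto simp: numeral_3_eq_3 length_Suc_conv)
      then show ?thesis using 0 by simp
    next
      case False
      then show ?thesis
        using wedge_contract_zero[OF F _ linear_inner] by (simp add: bracket_def bracket_decomp_def)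
    qed
  qed
  then have "bracket (contract X F) F = zero_form \<longleftrightarrow> (\<forall>x y z. bracket (contract X F) F [x, y, z] = 0)"
    by metis
  then show ?thesis by (simp only: bracket_contract_three_form[OF F] br_def)
qed

lemma metric_lie_algebra_three_form:
  assumes F: "F \<in> forms 3" and 0: "\<And>X. bracket (contract X F) F = zero_form"
  shows "metric_lie_algebra (three_form_bracket F)"
proof
  note inner = three_form_bracket_inner[OF F]
  show bil: "bilinear (three_form_bracket F)" by (rule bilinear_three_form_bracket[OF F])
  show anti: "three_form_bracket F y x = - three_form_bracket F x y" for x y
    by (rule vector_eq_rdot[THEN iffD1]) (simp add: inner inner_minus_left three_form_swap(1)[OF F, of y x])
  show inv: "three_form_bracket F x y \<bullet> z = x \<bullet> three_form_bracket F y z" for x y z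
    by (simp add: inner inner_commute[of x] three_form_cycle[OF F, of x])
  show "three_form_bracket F x (three_form_bracket F y z) =
      three_form_bracket F (three_form_bracket F x y) z + three_form_bracket F y (three_form_bracket F x z)"
    (is "?l = ?r") for x y z
  proof (rule vector_eq_rdot[THEN iffD1], rule allI)
    fix w
    let ?b = "three_form_bracket F"
    have 1: "?b x (?b y z) \<bullet> w = ?b y z \<bullet> ?b w x" and 2: "?b (?b x y) z \<bullet> w = ?b x y \<bullet> ?b z w"
      and 3: "?b y (?b x z) \<bullet> w = ?b x z \<bullet> ?b w y" for w
      using inv[of w x "?b y z"] inv[of "?b x y" z w] inv[of w y "?b x z"]
      by (simp_all add: inner_commute)
    \<comment> \<open>This is the instance \<open>X = x\<close> with arguments \<open>y\<close>,
      \<open>z\<close>, \<open>w\<close>; pairing the Jacobi identity with \<open>w\<close> and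
      using invariance gives the same three products.\<close>
    have "?b x y \<bullet> ?b z w - ?b x z \<bullet> ?b y w + ?b x w \<bullet> ?b y z = 0"
      using 0[of x] by (simp add: bracket_contract_zero_iff[OF F])
    then show "?l \<bullet> w = ?r \<bullet> w"
      unfolding inner_add_left 1 2 3
      using anti[of w x] anti[of w y] by (simp add: inner_commute)
  qed
qed

section \<open>Simple 3-forms and the orthogonality of their factors\<close>

lemma wedge_list_inner:
  "wedge_list [inner a, inner b, inner c] [x, y, z] = wedge_bracket a b c x y \<bullet> z"
  unfolding wedge_list_Cons[of "inner a"] wedge_3 wedge_list_2
  by (simp add: wedge_bracket_def inner_add_left algebra_simps)

lemma simple_form_wedge_inner: "simple_form 3 (wedge_list [inner a, inner b, inner c])"
  unfolding simple_form_def simple_factors_def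
  by (intro exI[of _ "[inner a, inner b, inner c]"]) (auto simp: linear_inner)

lemma simple_form_3E:
  fixes \<Omega> :: "'a::euclidean_space form"
  assumes "simple_form 3 \<Omega>"
  obtains a b c where "\<Omega> = wedge_list [inner a, inner b, inner c]"
proof -
  obtain \<alpha>s where \<alpha>s: "length \<alpha>s = 3" "\<forall>\<alpha>\<in>set \<alpha>s. linear \<alpha>" "\<Omega> = wedge_list \<alpha>s"
    using assms by (auto simp: simple_form_def simple_factors_def)
  have "map (\<lambda>\<alpha>. inner (sharp \<alpha>)) \<alpha>s = \<alpha>s"
    using \<alpha>s(2) by (intro map_idI) (auto simp: sharp_inner)
  moreover obtain \<alpha> \<beta> \<gamma> where "\<alpha>s = [\<alpha>, \<beta>, \<gamma>]"
    using \<alpha>s(1) by (auto simp: numeral_3_eq_3 length_Suc_conv)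
  ultimately have "\<alpha>s = [inner (sharp \<alpha>), inner (sharp \<beta>), inner (sharp \<gamma>)]" by simp
  then show ?thesis using that \<alpha>s(3) by metis
qed

lemma form_plane_wedge_inner:
  assumes "wedge_list [inner a, inner b, inner c] \<noteq> zero_form"
  shows "form_plane 3 (wedge_list [inner a, inner b, inner c]) = span {a, b, c}"
  using form_plane_eq[OF _ assms, of 3 "[inner a, inner b, inner c]"]
  by (simp add: simple_factors_def linear_inner)

lemma orthogonal_forms_wedge_inner:
  assumes "\<And>x y. x \<in> {a1, a2, a3} \<Longrightarrow> y \<in> {b1, b2, b3} \<Longrightarrow> x \<bullet> y = 0"
  shows "orthogonal_forms 3 (wedge_list [inner a1, inner a2, inner a3])
    (wedge_list [inner b1, inner b2, inner b3])"
proof -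
  have "x \<bullet> y = 0" if x: "x \<in> span {a1, a2, a3}" and y: "y \<in> span {b1, b2, b3}" for x y
  proof -
    have "orthogonal v y" if "v \<in> {a1, a2, a3}" for v
      by (rule orthogonal_to_span[OF y]) (use assms that in \<open>auto simp: orthogonal_def\<close>)
    then have "orthogonal y x"
      by (intro orthogonal_to_span[OF x]) (simp add: orthogonal_commute)
    then show ?thesis by (simp add: orthogonal_def inner_commute)
  qed
  then show ?thesis
    unfolding orthogonal_forms_def using form_plane_wedge_inner by blast
qed

text \<open>Planes are compared only when both forms are nonzero. A zero form may come with
  arbitrary factors, so it is rewritten with zero vectors, and the factors are then orthogonal in
  every case.\<close>

lemma orthogonal_simple_formsE:
  assumes "simple_form 3 F1" "simple_form 3 F2" "orthogonal_forms 3 F1 F2"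
  obtains a1 a2 a3 b1 b2 b3 where
    "F1 = wedge_list [inner a1, inner a2, inner a3]" "F2 = wedge_list [inner b1, inner b2, inner b3]"
    "\<And>x y. x \<in> {a1, a2, a3} \<Longrightarrow> y \<in> {b1, b2, b3} \<Longrightarrow> x \<bullet> y = 0"
proof -
  have zero: "zero_form = wedge_list [inner 0, inner 0, inner (0::'a)]"
    by (simp add: fun_eq_iff wedge_def)
  obtain a1 a2 a3 where a: "F1 = wedge_list [inner a1, inner a2, inner a3]"
    using simple_form_3E[OF assms(1)] .
  obtain b1 b2 b3 where b: "F2 = wedge_list [inner b1, inner b2, inner b3]"
    using simple_form_3E[OF assms(2)] .
  consider "F1 = zero_form" | "F2 = zero_form" | "F1 \<noteq> zero_form" "F2 \<noteq> zero_form" by blast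
  then show ?thesis
  proof cases
    case 1
    show ?thesis by (rule that[OF trans[OF 1 zero] b]) auto
  next
    case 2
    show ?thesis by (rule that[OF a trans[OF 2 zero]]) auto
  next
    case 3
    then have "form_plane 3 F1 = span {a1, a2, a3}" "form_plane 3 F2 = span {b1, b2, b3}"
      unfolding a b using form_plane_wedge_inner by blast+
    then show ?thesis
      using assms(3) 3 by (intro that[OF a b]) (auto simp: orthogonal_forms_def span_base)
  qed
qed

text \<open>A polynomial identity in the inner products, valid for arbitrary \<open>a\<close>,
  \<open>b\<close>, \<open>c\<close>: on their span the bracket is a possibly zero multiple of a
  cross product.\<close>

lemma wedge_bracket_jacobi:
  fixes a b c :: "'a::real_inner"
  defines "br \<equiv> wedge_bracket a b c"
  shows "br X x \<bullet> br y z - br X y \<bullet> br x z + br X z \<bullet> br x y = 0"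
proof -
  note comm = inner_commute[of b a] inner_commute[of c a] inner_commute[of c b]
  show ?thesis
    unfolding br_def wedge_bracket_def
    by (simp only: inner_add_left inner_add_right comm inner_scaleR_left inner_scaleR_right)
      (simp only: algebra_simps)
qed

theorem mainTheorem2:
  fixes F :: "'a::euclidean_space form"
  assumes "DIM('a) = 7" and "F \<in> forms 3"
  shows "(\<forall>X. bracket (contract X F) F = zero_form) \<longleftrightarrow>
    (\<exists>F1 F2. simple_form 3 F1 \<and> simple_form 3 F2 \<and> orthogonal_forms 3 F1 F2 \<and>
      F = (\<lambda>vs. F1 vs + F2 vs))"
proof
  assume "\<forall>X. bracket (contract X F) F = zero_form"
  then interpret metric_lie_algebra "three_form_bracket F"
    using metric_lie_algebra_three_form[OF assms(2)] by blast
  obtain a1 a2 a3 b1 b2 b3 where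
    orth: "\<And>a b. a \<in> {a1, a2, a3} \<Longrightarrow> b \<in> {b1, b2, b3} \<Longrightarrow> a \<bullet> b = 0" and
    br: "\<And>x y. three_form_bracket F x y = wedge_bracket a1 a2 a3 x y + wedge_bracket b1 b2 b3 x y"
    using seven_dimensional_decomposition[OF assms(1)] by metis
  define F1 F2 where "F1 = wedge_list [inner a1, inner a2, inner a3]"
    and "F2 = wedge_list [inner b1, inner b2, inner b3]"
  have simple: "simple_form 3 F1" "simple_form 3 F2"
    unfolding F1_def F2_def by (rule simple_form_wedge_inner)+
  have "F vs = F1 vs + F2 vs" for vs
  proof (cases "length vs = 3")
    case True
    then obtain x y z where vs: "vs = [x, y, z]"
      by (auto simp: numeral_3_eq_3 length_Suc_conv)
    show ?thesis
      unfolding vs F1_def F2_def wedge_list_inner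
      using three_form_bracket_inner[OF assms(2), of x y z] by (simp add: br inner_add_left)
  next
    case False
    then show ?thesis
      using forms_length[OF assms(2)] simple[THEN simple_form_forms, THEN forms_length] by simp
  qed
  then show "\<exists>F1 F2. simple_form 3 F1 \<and> simple_form 3 F2 \<and> orthogonal_forms 3 F1 F2 \<and>
      F = (\<lambda>vs. F1 vs + F2 vs)"
    using simple orthogonal_forms_wedge_inner[OF orth] unfolding F1_def F2_def by blast
next
  assume "\<exists>F1 F2. simple_form 3 F1 \<and> simple_form 3 F2 \<and> orthogonal_forms 3 F1 F2 \<and>
      F = (\<lambda>vs. F1 vs + F2 vs)"
  then obtain F1 F2 where F12: "simple_form 3 F1" "simple_form 3 F2" "orthogonal_forms 3 F1 F2"
    and F: "F = (\<lambda>vs. F1 vs + F2 vs)" by blast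
  obtain a1 a2 a3 b1 b2 b3 where ab: "F1 = wedge_list [inner a1, inner a2, inner a3]"
    "F2 = wedge_list [inner b1, inner b2, inner b3]"
    and orth: "\<And>x y. x \<in> {a1, a2, a3} \<Longrightarrow> y \<in> {b1, b2, b3} \<Longrightarrow> x \<bullet> y = 0"
    using orthogonal_simple_formsE[OF F12] by metis
  let ?A = "wedge_bracket a1 a2 a3" and ?B = "wedge_bracket b1 b2 b3"
  have br: "three_form_bracket F x y = ?A x y + ?B x y" for x y
  proof (rule vector_eq_rdot[THEN iffD1], rule allI)
    fix z
    have "F [x, y, z] = F1 [x, y, z] + F2 [x, y, z]" by (simp only: F)
    then show "three_form_bracket F x y \<bullet> z = (?A x y + ?B x y) \<bullet> z"
      unfolding ab wedge_list_inner by (simp only: three_form_bracket_inner[OF assms(2)] inner_add_left)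
  qed
  \<comment> \<open>The two brackets take values in the orthogonal spans of the two triples, so
    mixed products vanish and the quadratic condition splits into one condition for each
    summand.\<close>
  have "?A x y \<bullet> ?B u v = 0" for x y u v
    using orth by (simp add: wedge_bracket_def inner_add_left inner_add_right)
  then have product: "three_form_bracket F x y \<bullet> three_form_bracket F u v = ?A x y \<bullet> ?A u v + ?B x y \<bullet> ?B u v"
    for x y u v
    by (simp add: br inner_add_left inner_add_right inner_commute[of "?B _ _" "?A _ _"])
  show "\<forall>X. bracket (contract X F) F = zero_form"
    unfolding bracket_contract_zero_iff[OF assms(2)] product
  proof (intro allI)
    fix X x y z
    show "?A X x \<bullet> ?A y z + ?B X x \<bullet> ?B y z - (?A X y \<bullet> ?A x z + ?B X y \<bullet> ?B x z)
        + (?A X z \<bullet> ?A x y + ?B X z \<bullet> ?B x y) = 0"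
      using wedge_bracket_jacobi[of a1 a2 a3 X x y z] wedge_bracket_jacobi[of b1 b2 b3 X x y z] by linarith
  qed
qed

end
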